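(* Let $G$ be a real reductive group, $H\subseteq G$ a reductive subgroup, $P=MAN\subseteq G$ and $P_H=M_HA_HN_H\subseteq H$ parabolic subgroups. Let $(\tau,E)$ be an irreducible finite-dimensional representation of $G$, and let $i:E'\hookrightarrow E$ be the unique irreducible subrepresentation of $\tau|_P$; write $E'\simeq\tau'\otimes e^{\mu'}\otimes\mathbf 1$ as a representation of $P=MAN$, with $\tau'$ an irreducible finite-dimensional representation of $M$ and $\mu'\in\mathfrak a^*$. Let $\xi$, $\eta$ be finite-dimensional representations of $M$, $M_H$, and let $\lambda\in\mathfrak a_{\mathbb C}^*$, $\nu\in\mathfrak a_{H,\mathbb C}^*$. Then for every $P_H$-equivariant quotient $p:E|_{P_H}\twoheadrightarrow E''$ with $E''\simeq\tau''\otimes e^{\mu''}\otimes\mathbf 1$ as $P_H$-representations, there is a unique linear map $$\Phi:\ \mathrm{Hom}_H\big(\mathrm{Ind}_P^G(\xi\otimes e^\lambda\otimes\mathbf 1),\mathrm{Ind}_{P_H}^H(\eta\otimes e^\nu\otimes\mathbf 1)\big)\to \mathrm{Hom}_H\big(\mathrm{Ind}_P^G((\xi\otimes\tau')\otimes e^{\lambda+\mu'}\otimes\mathbf 1),\mathrm{Ind}_{P_H}^H((\eta\otimes\tau'')\otimes e^{\nu+\mu''}\otimes\mathbf 1)\big)$$ with the property that for every intertwining operator $A$ with distribution kernel $K^A$, the distribution kernel of $\Phi(A)$ is $K^{\Phi(A)}=\varphi\otimes K^A$, the multiplication of $K^A$ with the smooth section $\varphi\in C^\infty(G/P,G\times_P(E')^\vee)\otimes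 E''$ defined by $$\varphi(g)=p\circ\tau(g)\circ i\in\mathrm{Hom}_{\mathbb C}(E',E'')\simeq(E')^\vee\otimes E'',\qquad g\in G.$$
   Context: $P=MAN$, $P_H=M_HA_HN_H$ are Langlands decompositions; $\mathfrak a,\mathfrak n,\mathfrak a_H,\mathfrak n_H$ are the Lie algebras of $A,N,A_H,N_H$; $\rho=\frac12\mathrm{tr}\,\mathrm{ad}_{\mathfrak n}\in\mathfrak a^*$, $\rho_H=\frac12\mathrm{tr}\,\mathrm{ad}_{\mathfrak n_H}\in\mathfrak a_H^*$; $\mathbf 1$ is the trivial representation. Put $V_\lambda=\xi\otimes e^{\lambda+\rho}\otimes\mathbf 1$ (a $P$-representation on the space $V$ of $\xi$), $\mathcal V_\lambda=G\times_PV_\lambda$, and let $\mathrm{Ind}_P^G(\xi\otimes e^\lambda\otimes\mathbf 1)$ be the left-regular representation of $G$ on $$C^\infty(G,V_\lambda)^P=\{f\in C^\infty(G,V): f(gman)=a^{-\lambda-\rho}\xi(m)^{-1}f(g)\}\simeq C^\infty(G/P,\mathcal V_\lambda).$$ Similarly $\mathrm{Ind}_{P_H}^H(\eta\otimes e^\nu\otimes\mathbf 1)$ is realized on $C^\infty(H,W_\nu)^{P_H}$ with $W_\nu=\eta\otimes e^{\nu+\rho_H}\otimes\mathbf 1$. $\mathrm{Hom}_H$ denotes continuous $H$-intertwining operators. Let $V_\lambda^*=\xi^\vee\otimes e^{-\lambda+\rho}\otimes\mathbf 1$, $\mathcal V_\lambda^*=G\times_PV_\lambda^*$, and let $\mathcal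 D'(G/P,\mathcal V_\lambda^* )$ be the topological dual of $C^\infty(G/P,\mathcal V_\lambda)$, which contains $C^\infty(G/P,\mathcal V_\lambda^* )$ via $\langle f,\psi\rangle=\int_K\langle f(k),\psi(k)\rangle\,dk$ ($K\subseteq G$ maximal compact). Every $A\in\mathrm{Hom}_H(\mathrm{Ind}_P^G(\xi\otimes e^\lambda\otimes\mathbf 1),\mathrm{Ind}_{P_H}^H(\eta\otimes e^\nu\otimes\mathbf 1))$ has a unique distribution kernel $K^A\in(\mathcal D'(G/P,\mathcal V_\lambda^* )\otimes W_\nu)^{\Delta(P_H)}$ (invariants under the diagonal action of $P_H$), characterized by $$Af(h)=\int_{G/P}c\big(f(x)\otimes K^A(h^{-1}x)\big)\,dx,\qquad h\in H,$$ in the distribution sense, where $c:V_\lambda\otimes V_\lambda^*\otimes W_\nu\to W_\nu$ is the contraction; $A\mapsto K^A$ is a linear isomorphism onto this space of invariants. For a finite-dimensional $P$-representation $F$ and $f\in C^\infty(G/P,G\times_PF)$, multiplication $u\mapsto f\otimes u$ on distribution sections is the transpose of the pointwise tensor product with $f$ followed by the contraction of $F$ with $F^\vee$. $(E')^\vee=\mathrm{Hom}_{\mathbb C}(E',\mathbb C)$. It is known that $\tau|_P$ has a unique irreducible subrepresentation $E'$, generated by the highest weight space, and that $N$ acts trivially on it. *)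

theory Defs
  imports "HOL-Analysis.Analysis" "HOL-Algebra.Group" "HOL-Library.FuncSet"
begin

section \<open>Smooth functions on open subsets of a linear subspace\<close>

definition dir_deriv :: "'a::real_normed_vector \<Rightarrow> ('a \<Rightarrow> 'b::real_normed_vector) \<Rightarrow> 'a \<Rightarrow> 'b" where
  "dir_deriv v f x = vector_derivative (\<lambda>t. f (x + t *\<^sub>R v)) (at 0)"

text \<open>\<open>S\<close> is a linear subspace and \<open>X\<close> is open in \<open>S\<close>. Working relative to a subspace of a Euclidean
  space, rather than on a whole Euclidean space, admits model spaces of dimension 0.\<close>

primrec Ck_on :: "nat \<Rightarrow> 'a::real_normed_vector set \<Rightarrow> 'a set \<Rightarrow> ('a \<Rightarrow> 'b::real_normed_vector) \<Rightarrow> bool"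
where
  "Ck_on 0 S X f \<longleftrightarrow> continuous_on X f"
| "Ck_on (Suc k) S X f \<longleftrightarrow>
     (\<forall>x\<in>X. f differentiable (at x within S)) \<and> (\<forall>v\<in>S. Ck_on k S X (dir_deriv v f))"

definition Cinf_on :: "'a::real_normed_vector set \<Rightarrow> 'a set \<Rightarrow> ('a \<Rightarrow> 'b::real_normed_vector) \<Rightarrow> bool" where
  "Cinf_on S X f \<longleftrightarrow> (\<forall>k. Ck_on k S X f)"


section \<open>Lie groups\<close>

record ('g, 'a) lie_struct = "'g monoid" +
  topo :: "'g topology"
  model :: "'a set"
  charts :: "('g set \<times> ('g \<Rightarrow> 'a)) set"

definition smooth_fun ::
  "('g, 'a::euclidean_space) lie_struct \<Rightarrow> 'g set \<Rightarrow> ('g \<Rightarrow> 'b::real_normed_vector) \<Rightarrow> bool" where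
  "smooth_fun L X f \<longleftrightarrow>
     (\<forall>(U, c) \<in> charts L. Cinf_on (model L) (c ` (U \<inter> X)) (f \<circ> inv_into U c))"

definition smooth_map ::
  "('g, 'a::euclidean_space) lie_struct \<Rightarrow> ('h, 'b::euclidean_space) lie_struct \<Rightarrow> ('g \<Rightarrow> 'h) \<Rightarrow> bool" where
  "smooth_map L L' f \<longleftrightarrow> continuous_map (topo L) (topo L') f \<and>
     (\<forall>(U, c) \<in> charts L. \<forall>(U', c') \<in> charts L'.
        Cinf_on (model L) (c ` {x \<in> U. f x \<in> U'}) (c' \<circ> f \<circ> inv_into U c))"

locale lie_group = group L for L :: "('g, 'a::euclidean_space) lie_struct" (structure) +
  assumes topspace_eq: "topspace (topo L) = carrier L"
    and Hausdorff: "Hausdorff_space (topo L)"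
    and second_countable: "second_countable (topo L)"
    and subspace_model: "subspace (model L)"
    and charts_cover: "(\<Union>(U, c) \<in> charts L. U) = carrier L"
    and chart: "(U, c) \<in> charts L \<Longrightarrow>
          openin (topo L) U \<and> openin (top_of_set (model L)) (c ` U) \<and>
          homeomorphic_map (subtopology (topo L) U) (top_of_set (c ` U)) c"
    and chart_transition: "(U, c) \<in> charts L \<Longrightarrow> (U', c') \<in> charts L \<Longrightarrow>
          Cinf_on (model L) (c ` (U \<inter> U')) (c' \<circ> inv_into U c)"
    and continuous_mult:
          "continuous_map (prod_topology (topo L) (topo L)) (topo L) (\<lambda>(x, y). x \<otimes> y)"
    and smooth_mult:
          "(U1, c1) \<in> charts L \<Longrightarrow> (U2, c2) \<in> charts L \<Longrightarrow> (U3, c3) \<in> charts L \<Longrightarrow>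
           Cinf_on (model L \<times> model L)
             {(s, t). s \<in> c1 ` U1 \<and> t \<in> c2 ` U2 \<and> inv_into U1 c1 s \<otimes> inv_into U2 c2 t \<in> U3}
             (\<lambda>(s, t). c3 (inv_into U1 c1 s \<otimes> inv_into U2 c2 t))"
    and smooth_inv: "smooth_map L L (\<lambda>x. inv x)"

text \<open>A closed subgroup carries a unique structure of embedded submanifold. It is characterized by
  inducing the subspace topology and having a smooth inclusion.\<close>

definition closed_lie_subgroup ::
  "('g, 'b::euclidean_space) lie_struct \<Rightarrow> ('g, 'a::euclidean_space) lie_struct \<Rightarrow> bool" where
  "closed_lie_subgroup H G \<longleftrightarrow> lie_group H \<and> lie_group G \<and>
     subgroup (carrier H) G \<and> closedin (topo G) (carrier H) \<and>
     (\<forall>x\<in>carrier H. \<forall>y\<in>carrier H. x \<otimes>\<^bsub>H\<^esub> y = x \<otimes>\<^bsub>G\<^esub> y) \<and>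
     topo H = subtopology (topo G) (carrier H) \<and> smooth_map H G (\<lambda>x. x)"

text \<open>The Lie algebra is the tangent space at the identity, identified with the model space through
  a fixed chart around the identity.\<close>

definition unit_coord :: "('g, 'a::euclidean_space) lie_struct \<Rightarrow> 'g \<Rightarrow> 'a" where
  "unit_coord L = snd (SOME c. c \<in> charts L \<and> \<one>\<^bsub>L\<^esub> \<in> fst c)"

definition one_param_subgroup ::
  "('g, 'a::euclidean_space) lie_struct \<Rightarrow> 'a \<Rightarrow> (real \<Rightarrow> 'g) \<Rightarrow> bool" where
  "one_param_subgroup L X \<gamma> \<longleftrightarrow> continuous_map euclideanreal (topo L) \<gamma> \<and>
     (\<forall>s t. \<gamma> (s + t) = \<gamma> s \<otimes>\<^bsub>L\<^esub> \<gamma> t) \<and>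
     ((\<lambda>t. unit_coord L (\<gamma> t)) has_vector_derivative X) (at 0)"

definition lie_exp :: "('g, 'a::euclidean_space) lie_struct \<Rightarrow> 'a \<Rightarrow> 'g" where
  "lie_exp L X = (THE \<gamma>. one_param_subgroup L X \<gamma>) 1"

definition Ad :: "('g, 'a::euclidean_space) lie_struct \<Rightarrow> 'g \<Rightarrow> 'a \<Rightarrow> 'a" where
  "Ad L g X = vector_derivative
     (\<lambda>t. unit_coord L (g \<otimes>\<^bsub>L\<^esub> lie_exp L (t *\<^sub>R X) \<otimes>\<^bsub>L\<^esub> inv\<^bsub>L\<^esub> g)) (at 0)"

definition lie_bracket :: "('g, 'a::euclidean_space) lie_struct \<Rightarrow> 'a \<Rightarrow> 'a \<Rightarrow> 'a" where
  "lie_bracket L X Y = vector_derivative (\<lambda>t. Ad L (lie_exp L (t *\<^sub>R X)) Y) (at 0)"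

definition lie_alg :: "('g, 'a::euclidean_space) lie_struct \<Rightarrow> 'g set \<Rightarrow> 'a set" where
  "lie_alg L S = {X \<in> model L. \<forall>t. lie_exp L (t *\<^sub>R X) \<in> S}"


section \<open>Real reductive groups and parabolic subgroups\<close>

definition lie_ideal :: "('g, 'a::euclidean_space) lie_struct \<Rightarrow> 'a set \<Rightarrow> bool" where
  "lie_ideal L I \<longleftrightarrow> subspace I \<and> I \<subseteq> model L \<and>
     (\<forall>X\<in>model L. \<forall>Y\<in>I. lie_bracket L X Y \<in> I)"

definition reductive_lie_algebra :: "('g, 'a::euclidean_space) lie_struct \<Rightarrow> bool" where
  "reductive_lie_algebra L \<longleftrightarrow> (\<forall>I. lie_ideal L I \<longrightarrow>
     (\<exists>J. lie_ideal L J \<and> I \<inter> J = {0} \<and> {X + Y |X Y. X \<in> I \<and> Y \<in> J} = model L))"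

definition cartan_p :: "('g, 'a::euclidean_space) lie_struct \<Rightarrow> ('a \<Rightarrow> 'a) \<Rightarrow> 'a set" where
  "cartan_p L \<theta> = {X \<in> model L. \<theta> X = - X}"

text \<open>\<open>K\<close> is a maximal compact subgroup, \<open>\<theta>\<close> a Cartan involution of the Lie algebra and \<open>B\<close> an invariant
  form, as in Knapp's definition of a reductive Lie group, but without requiring the automorphisms
  \<open>Ad g\<close> to be inner on the complexified Lie algebra. Groups such as \<open>O(p,q)\<close> and all groups in the
  Harish-Chandra class are covered. The last two clauses say that \<open>(k, X) \<mapsto> k exp X\<close> is a
  diffeomorphism from \<open>K \<times> \<pp>\<close> onto the group, with inverse \<open>g \<mapsto> (\<kappa> g, \<Xi> g)\<close>.\<close>

definition reductive_structure ::
  "('g, 'a::euclidean_space) lie_struct \<Rightarrow> 'g set \<Rightarrow> ('a \<Rightarrow> 'a) \<Rightarrow> ('a \<Rightarrow> 'a \<Rightarrow> real) \<Rightarrow> bool" where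
  "reductive_structure L K \<theta> B \<longleftrightarrow>
     lie_group L \<and> reductive_lie_algebra L \<and>
     subgroup K L \<and> compactin (topo L) K \<and>
     linear \<theta> \<and>
     (\<forall>X\<in>model L. \<theta> X \<in> model L \<and> \<theta> (\<theta> X) = X) \<and>
     (\<forall>X\<in>model L. \<forall>Y\<in>model L. \<theta> (lie_bracket L X Y) = lie_bracket L (\<theta> X) (\<theta> Y)) \<and>
     lie_alg L K = {X \<in> model L. \<theta> X = X} \<and>
     bilinear B \<and>
     (\<forall>X\<in>model L. \<forall>Y\<in>model L. B X Y = B Y X \<and> B (\<theta> X) (\<theta> Y) = B X Y \<and>
        (\<forall>g\<in>carrier L. B (Ad L g X) (Ad L g Y) = B X Y)) \<and>
     (\<forall>X\<in>lie_alg L K. \<forall>Y\<in>cartan_p L \<theta>. B X Y = 0) \<and>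
     (\<forall>X\<in>lie_alg L K. X \<noteq> 0 \<longrightarrow> B X X < 0) \<and>
     (\<forall>X\<in>cartan_p L \<theta>. X \<noteq> 0 \<longrightarrow> B X X > 0) \<and>
     (\<exists>\<kappa> \<Xi>. smooth_map L L \<kappa> \<and> smooth_fun L (carrier L) \<Xi> \<and>
        (\<forall>g\<in>carrier L. \<kappa> g \<in> K \<and> \<Xi> g \<in> cartan_p L \<theta> \<and> \<kappa> g \<otimes>\<^bsub>L\<^esub> lie_exp L (\<Xi> g) = g) \<and>
        (\<forall>k\<in>K. \<forall>X\<in>cartan_p L \<theta>.
           \<kappa> (k \<otimes>\<^bsub>L\<^esub> lie_exp L X) = k \<and> \<Xi> (k \<otimes>\<^bsub>L\<^esub> lie_exp L X) = X))"

definition real_reductive :: "('g, 'a::euclidean_space) lie_struct \<Rightarrow> bool" where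
  "real_reductive L \<longleftrightarrow> (\<exists>K \<theta> B. reductive_structure L K \<theta> B)"

definition reductive_subgroup ::
  "('g, 'b::euclidean_space) lie_struct \<Rightarrow> ('g, 'a::euclidean_space) lie_struct \<Rightarrow> bool" where
  "reductive_subgroup H G \<longleftrightarrow> closed_lie_subgroup H G \<and> real_reductive H"

definition centralizer_of :: "('g, 'a::euclidean_space) lie_struct \<Rightarrow> 'a set \<Rightarrow> 'g set" where
  "centralizer_of L \<aa> = {g \<in> carrier L. \<forall>X\<in>\<aa>. Ad L g X = X}"

text \<open>Restricted root space for \<open>\<alpha> \<in> \<aa>\<^sup>*\<close>; only the values of \<open>\<alpha>\<close> on \<open>\<aa>\<close> matter.\<close>

definition root_space ::
  "('g, 'a::euclidean_space) lie_struct \<Rightarrow> 'a set \<Rightarrow> ('a \<Rightarrow> real) \<Rightarrow> 'a set" where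
  "root_space L \<aa> \<alpha> = {X \<in> model L. \<forall>Y\<in>\<aa>. lie_bracket L Y X = \<alpha> Y *\<^sub>R X}"

definition restricted_root ::
  "('g, 'a::euclidean_space) lie_struct \<Rightarrow> 'a set \<Rightarrow> ('a \<Rightarrow> real) \<Rightarrow> bool" where
  "restricted_root L \<aa> \<alpha> \<longleftrightarrow> (\<exists>Y\<in>\<aa>. \<alpha> Y \<noteq> 0) \<and> (\<exists>X\<in>root_space L \<aa> \<alpha>. X \<noteq> 0)"

text \<open>\<open>\<^sup>0S\<close>: the common kernel of all continuous homomorphisms of \<open>S\<close> to the positive reals.\<close>

definition anisotropic_part :: "('g, 'a::euclidean_space) lie_struct \<Rightarrow> 'g set \<Rightarrow> 'g set" where
  "anisotropic_part L S = {m \<in> S. \<forall>\<omega> :: 'g \<Rightarrow> real.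
     continuous_map (subtopology (topo L) S) euclideanreal \<omega> \<longrightarrow>
     (\<forall>x\<in>S. \<omega> x > 0) \<longrightarrow> (\<forall>x\<in>S. \<forall>y\<in>S. \<omega> (x \<otimes>\<^bsub>L\<^esub> y) = \<omega> x * \<omega> y) \<longrightarrow> \<omega> m = 1}"

text \<open>Parabolic subgroup \<open>P\<close> with Langlands decomposition \<open>P = M A N\<close>: \<open>\<aa>\<close> is the split component of
  its own centralizer \<open>Z\<close>, \<open>A = exp \<aa>\<close>, \<open>M = \<^sup>0Z\<close>, and \<open>N\<close> is the exponential of the sum of the root
  spaces for a system of positive restricted roots, given by a regular element \<open>X0\<close> of its chamber. That the resulting sets are subgroups
  and \<open>P\<close> is closed follows from the other clauses; it is recorded as part of the definition.\<close>

definition parabolic_subgroup ::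
  "('g, 'a::euclidean_space) lie_struct \<Rightarrow> 'g set \<Rightarrow> 'g set \<Rightarrow> 'g set \<Rightarrow> 'g set \<Rightarrow> bool" where
  "parabolic_subgroup L P M A N \<longleftrightarrow>
     subgroup P L \<and> closedin (topo L) P \<and> subgroup M L \<and> subgroup A L \<and> subgroup N L \<and>
     (\<exists>K \<theta> B \<aa> X0. reductive_structure L K \<theta> B \<and>
        subspace \<aa> \<and> (\<forall>X\<in>\<aa>. \<forall>Y\<in>\<aa>. lie_bracket L X Y = 0) \<and>
        \<aa> = {X \<in> cartan_p L \<theta>. \<forall>g\<in>centralizer_of L \<aa>. Ad L g X = X} \<and>
        X0 \<in> \<aa> \<and> (\<forall>\<alpha>. restricted_root L \<aa> \<alpha> \<longrightarrow> \<alpha> X0 \<noteq> 0) \<and>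
        M = anisotropic_part L (centralizer_of L \<aa>) \<and>
        A = lie_exp L ` \<aa> \<and>
        N = lie_exp L ` span (\<Union>\<alpha>\<in>{\<alpha>. restricted_root L \<aa> \<alpha> \<and> \<alpha> X0 > 0}. root_space L \<aa> \<alpha>) \<and>
        P = {m \<otimes>\<^bsub>L\<^esub> a \<otimes>\<^bsub>L\<^esub> n |m a n. m \<in> M \<and> a \<in> A \<and> n \<in> N})"

definition trace_on :: "'a::real_vector set \<Rightarrow> ('a \<Rightarrow> 'a) \<Rightarrow> real" where
  "trace_on S f = (let Q = (SOME Q. independent Q \<and> span Q = S) in \<Sum>b\<in>Q. representation Q (f b) b)"

definition rho :: "('g, 'a::euclidean_space) lie_struct \<Rightarrow> 'g set \<Rightarrow> 'a \<Rightarrow> real" where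
  "rho L N X = trace_on (lie_alg L N) (lie_bracket L X) / 2"

text \<open>\<open>a\<^sup>\<mu> = e\<^bsup>\<mu>(log a)\<^esup>\<close> for \<open>a \<in> A\<close>. Functionals on the Lie algebra of \<open>A\<close> are given by linear
  functionals on the ambient space, of which only the restriction matters.\<close>

definition a_power ::
  "('g, 'a::euclidean_space) lie_struct \<Rightarrow> 'g set \<Rightarrow> ('a \<Rightarrow> complex) \<Rightarrow> 'g \<Rightarrow> complex" where
  "a_power L A \<mu> a = exp (\<mu> (THE X. X \<in> lie_alg L A \<and> lie_exp L X = a))"


section \<open>Finite-dimensional representations\<close>

text \<open>A function on a subset of a manifold is smooth if it locally extends to a smooth function on
  an open set. For closed subgroups this is smoothness on the embedded submanifold.\<close>

definition smooth_on_subset ::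
  "('g, 'a::euclidean_space) lie_struct \<Rightarrow> 'g set \<Rightarrow> ('g \<Rightarrow> 'b::real_normed_vector) \<Rightarrow> bool" where
  "smooth_on_subset L S f \<longleftrightarrow> (\<forall>x\<in>S. \<exists>U f'. openin (topo L) U \<and> x \<in> U \<and>
     smooth_fun L U f' \<and> (\<forall>y\<in>U \<inter> S. f' y = f y))"

definition fin_rep ::
  "('g, 'a::euclidean_space) lie_struct \<Rightarrow> 'g set \<Rightarrow> ('g \<Rightarrow> complex^'n^'n) \<Rightarrow> bool" where
  "fin_rep L S \<xi> \<longleftrightarrow> smooth_on_subset L S \<xi> \<and> \<xi> \<one>\<^bsub>L\<^esub> = mat 1 \<and>
     (\<forall>x\<in>S. \<forall>y\<in>S. \<xi> (x \<otimes>\<^bsub>L\<^esub> y) = \<xi> x ** \<xi> y)"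

definition invariant_subspace :: "'g set \<Rightarrow> ('g \<Rightarrow> complex^'n^'n) \<Rightarrow> (complex^'n) set \<Rightarrow> bool" where
  "invariant_subspace S \<xi> F \<longleftrightarrow> vec.subspace F \<and> (\<forall>g\<in>S. \<forall>x\<in>F. \<xi> g *v x \<in> F)"

definition irreducible_subrep :: "'g set \<Rightarrow> ('g \<Rightarrow> complex^'n^'n) \<Rightarrow> (complex^'n) set \<Rightarrow> bool" where
  "irreducible_subrep S \<xi> F \<longleftrightarrow> invariant_subspace S \<xi> F \<and> F \<noteq> {0} \<and>
     (\<forall>F'. invariant_subspace S \<xi> F' \<longrightarrow> F' \<subseteq> F \<longrightarrow> F' = {0} \<or> F' = F)"

definition irreducible_rep ::
  "('g, 'a::euclidean_space) lie_struct \<Rightarrow> 'g set \<Rightarrow> ('g \<Rightarrow> complex^'n^'n) \<Rightarrow> bool" where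
  "irreducible_rep L S \<xi> \<longleftrightarrow> fin_rep L S \<xi> \<and> irreducible_subrep S \<xi> UNIV"

definition tensor_rep ::
  "('g \<Rightarrow> complex^'m^'m) \<Rightarrow> ('g \<Rightarrow> complex^'n^'n) \<Rightarrow> 'g \<Rightarrow> complex^('m \<times> 'n)^('m \<times> 'n)" where
  "tensor_rep \<xi> \<sigma> g = (\<chi> r s. \<xi> g $ fst r $ fst s * \<sigma> g $ snd r $ snd s)"

text \<open>The representation \<open>\<sigma> \<otimes> e\<^sup>\<mu> \<otimes> \<one>\<close> of \<open>M A N\<close>, evaluated at \<open>m a n\<close>.\<close>

definition man_action ::
  "('g, 'a::euclidean_space) lie_struct \<Rightarrow> 'g set \<Rightarrow> ('g \<Rightarrow> complex^'n^'n) \<Rightarrow> ('a \<Rightarrow> complex) \<Rightarrow>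
   'g \<Rightarrow> 'g \<Rightarrow> complex^'n \<Rightarrow> complex^'n" where
  "man_action L A \<sigma> \<mu> m a x = a_power L A \<mu> a *s (\<sigma> m *v x)"


section \<open>Principal series and intertwining operators\<close>

text \<open>Sections, operators on sections and distributions are total functions, extended by zero
  outside their proper domains. \<open>Ind\<close> is the space \<open>C\<^sup>\<infinity>(L, V\<^sub>\<lambda>)\<^sup>P\<close>,
  with \<open>lam\<close> standing for \<open>\<lambda>\<close>.\<close>

definition Ind ::
  "('g, 'a::euclidean_space) lie_struct \<Rightarrow> 'g set \<Rightarrow> 'g set \<Rightarrow> 'g set \<Rightarrow>
   ('g \<Rightarrow> complex^'v^'v) \<Rightarrow> ('a \<Rightarrow> complex) \<Rightarrow> ('g \<Rightarrow> complex^'v) set" where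
  "Ind L M A N \<xi> lam = {f. (\<forall>x. x \<notin> carrier L \<longrightarrow> f x = 0) \<and> smooth_fun L (carrier L) f \<and>
     (\<forall>g\<in>carrier L. \<forall>m\<in>M. \<forall>a\<in>A. \<forall>n\<in>N.
        f (g \<otimes>\<^bsub>L\<^esub> (m \<otimes>\<^bsub>L\<^esub> a \<otimes>\<^bsub>L\<^esub> n)) =
        a_power L A (\<lambda>X. - lam X - of_real (rho L N X)) a *s (\<xi> (inv\<^bsub>L\<^esub> m) *v f g))}"

definition left_translate ::
  "('g, 'a::euclidean_space) lie_struct \<Rightarrow> 'g \<Rightarrow> ('g \<Rightarrow> 'b::zero) \<Rightarrow> 'g \<Rightarrow> 'b" where
  "left_translate L h f = (\<lambda>x. if x \<in> carrier L then f (inv\<^bsub>L\<^esub> h \<otimes>\<^bsub>L\<^esub> x) else 0)"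

text \<open>The topology of \<open>C\<^sup>\<infinity>\<close>: uniform convergence of all derivatives on compact sets, in charts.\<close>

definition Cinf_ball ::
  "('g, 'a::euclidean_space) lie_struct \<Rightarrow> ('g \<Rightarrow> 'b::real_normed_vector) set \<Rightarrow>
   'g set \<times> ('g \<Rightarrow> 'a) \<Rightarrow> 'a set \<Rightarrow> 'a list \<Rightarrow> ('g \<Rightarrow> 'b) \<Rightarrow> real \<Rightarrow> ('g \<Rightarrow> 'b) set" where
  "Cinf_ball L \<F> c C vs f e = {f' \<in> \<F>. \<forall>x\<in>C.
     norm (foldr dir_deriv vs ((\<lambda>g. f' g - f g) \<circ> inv_into (fst c) (snd c)) x) < e}"

definition Cinf_topology ::
  "('g, 'a::euclidean_space) lie_struct \<Rightarrow> ('g \<Rightarrow> 'b::real_normed_vector) set \<Rightarrow> ('g \<Rightarrow> 'b) topology" where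
  "Cinf_topology L \<F> = topology_generated_by
     {Cinf_ball L \<F> c C vs f e |c C vs f e.
        c \<in> charts L \<and> compact C \<and> C \<subseteq> snd c ` fst c \<and> set vs \<subseteq> model L \<and> f \<in> \<F> \<and> e > 0}"

definition intertwiners ::
  "('g, 'a::euclidean_space) lie_struct \<Rightarrow> ('g, 'b::euclidean_space) lie_struct \<Rightarrow>
   ('g \<Rightarrow> complex^'v) set \<Rightarrow> ('g \<Rightarrow> complex^'w) set \<Rightarrow>
   (('g \<Rightarrow> complex^'v) \<Rightarrow> 'g \<Rightarrow> complex^'w) set" where
  "intertwiners G H \<F> \<H> = {T.
     (\<forall>f. f \<notin> \<F> \<longrightarrow> T f = (\<lambda>_. 0)) \<and> (\<forall>f\<in>\<F>. T f \<in> \<H>) \<and>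
     (\<forall>f1\<in>\<F>. \<forall>f2\<in>\<F>. T (\<lambda>x. f1 x + f2 x) = (\<lambda>x. T f1 x + T f2 x)) \<and>
     (\<forall>z. \<forall>f\<in>\<F>. T (\<lambda>x. z *s f x) = (\<lambda>x. z *s T f x)) \<and>
     continuous_map (Cinf_topology G \<F>) (Cinf_topology H \<H>) T \<and>
     (\<forall>h\<in>carrier H. \<forall>f\<in>\<F>. T (left_translate G h f) = left_translate H h (T f))}"

definition linear_on_intertwiners ::
  "(('g \<Rightarrow> complex^'v) \<Rightarrow> 'g \<Rightarrow> complex^'w) set \<Rightarrow>
   ((('g \<Rightarrow> complex^'v) \<Rightarrow> 'g \<Rightarrow> complex^'w) \<Rightarrow>
    (('g \<Rightarrow> complex^'v2) \<Rightarrow> 'g \<Rightarrow> complex^'w2)) \<Rightarrow> bool" where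
  "linear_on_intertwiners \<T> \<Phi> \<longleftrightarrow>
     (\<forall>S\<in>\<T>. \<forall>T\<in>\<T>. \<Phi> (\<lambda>f x. S f x + T f x) = (\<lambda>f x. \<Phi> S f x + \<Phi> T f x)) \<and>
     (\<forall>z. \<forall>T\<in>\<T>. \<Phi> (\<lambda>f x. z *s T f x) = (\<lambda>f x. z *s \<Phi> T f x))"


section \<open>Distribution kernels\<close>

text \<open>For \<open>\<F> = C\<^sup>\<infinity>(G/P, \<V>\<^sub>\<lambda>)\<close>, an element of \<open>\<D>'(G/P, \<V>\<^sub>\<lambda>\<^sup>*) \<otimes> W\<close> is a continuous linear map
  \<open>\<F> \<rightarrow> W\<close>; applying it to \<open>f\<close> is \<open>\<integral> c(f(x) \<otimes> K(x)) dx\<close>.\<close>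

definition distributions ::
  "('g, 'a::euclidean_space) lie_struct \<Rightarrow> ('g \<Rightarrow> complex^'v) set \<Rightarrow>
   (('g \<Rightarrow> complex^'v) \<Rightarrow> complex^'w) set" where
  "distributions G \<F> = {K.
     (\<forall>f. f \<notin> \<F> \<longrightarrow> K f = 0) \<and>
     (\<forall>f1\<in>\<F>. \<forall>f2\<in>\<F>. K (\<lambda>x. f1 x + f2 x) = K f1 + K f2) \<and>
     (\<forall>z. \<forall>f\<in>\<F>. K (\<lambda>x. z *s f x) = z *s K f) \<and>
     continuous_map (Cinf_topology G \<F>) euclidean K}"

text \<open>The translate \<open>x \<mapsto> K(h\<^sup>-\<^sup>1x)\<close> of a distribution \<open>K\<close>.\<close>

definition dist_translate ::
  "('g, 'a::euclidean_space) lie_struct \<Rightarrow> 'g \<Rightarrow> (('g \<Rightarrow> complex^'v) \<Rightarrow> complex^'w) \<Rightarrow>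
   ('g \<Rightarrow> complex^'v) \<Rightarrow> complex^'w" where
  "dist_translate G h K f = K (left_translate G (inv\<^bsub>G\<^esub> h) f)"

text \<open>\<open>(\<D>'(G/P, \<V>\<^sub>\<lambda>\<^sup>*) \<otimes> W\<^sub>\<nu>)\<^bsup>\<Delta>(P\<^sub>H)\<^esup>\<close>, where \<open>M A N\<close> is the Langlands decomposition of \<open>P\<^sub>H \<subseteq> H\<close>.\<close>

definition invariant_distributions ::
  "('g, 'a::euclidean_space) lie_struct \<Rightarrow> ('g, 'b::euclidean_space) lie_struct \<Rightarrow>
   'g set \<Rightarrow> 'g set \<Rightarrow> 'g set \<Rightarrow> ('g \<Rightarrow> complex^'w^'w) \<Rightarrow> ('b \<Rightarrow> complex) \<Rightarrow>
   ('g \<Rightarrow> complex^'v) set \<Rightarrow> (('g \<Rightarrow> complex^'v) \<Rightarrow> complex^'w) set" where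
  "invariant_distributions G H M A N \<eta> \<nu> \<F> = {K \<in> distributions G \<F>.
     \<forall>m\<in>M. \<forall>a\<in>A. \<forall>n\<in>N. \<forall>f\<in>\<F>.
       man_action H A \<eta> (\<lambda>X. \<nu> X + of_real (rho H N X)) m a
         (dist_translate G (m \<otimes>\<^bsub>H\<^esub> a \<otimes>\<^bsub>H\<^esub> n) K f) = K f}"

definition dist_kernel ::
  "('g, 'a::euclidean_space) lie_struct \<Rightarrow> ('g, 'b::euclidean_space) lie_struct \<Rightarrow>
   'g set \<Rightarrow> 'g set \<Rightarrow> 'g set \<Rightarrow> ('g \<Rightarrow> complex^'w^'w) \<Rightarrow> ('b \<Rightarrow> complex) \<Rightarrow>
   ('g \<Rightarrow> complex^'v) set \<Rightarrow> (('g \<Rightarrow> complex^'v) \<Rightarrow> 'g \<Rightarrow> complex^'w) \<Rightarrow>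
   (('g \<Rightarrow> complex^'v) \<Rightarrow> complex^'w)" where
  "dist_kernel G H M A N \<eta> \<nu> \<F> T = (THE K.
     K \<in> invariant_distributions G H M A N \<eta> \<nu> \<F> \<and>
     (\<forall>f\<in>\<F>. \<forall>h\<in>carrier H. T f h = dist_translate G h K f))"

text \<open>\<open>C\<^sup>\<infinity>(G/P, G \<times>\<^sub>P (E')\<^sup>\<or>) \<otimes> E''\<close>, where \<open>E' = \<sigma> \<otimes> e\<^sup>\<mu> \<otimes> \<one>\<close> as a representation of \<open>P = M A N\<close> and
  \<open>(E')\<^sup>\<or> \<otimes> E'' = Hom(E', E'')\<close> is identified with a space of matrices.\<close>

definition hom_sections ::
  "('g, 'a::euclidean_space) lie_struct \<Rightarrow> 'g set \<Rightarrow> 'g set \<Rightarrow> 'g set \<Rightarrow>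
   ('g \<Rightarrow> complex^'e1^'e1) \<Rightarrow> ('a \<Rightarrow> complex) \<Rightarrow> ('g \<Rightarrow> complex^'e1^'e2) set" where
  "hom_sections G M A N \<sigma> \<mu> = {\<phi>. (\<forall>x. x \<notin> carrier G \<longrightarrow> \<phi> x = 0) \<and> smooth_fun G (carrier G) \<phi> \<and>
     (\<forall>g\<in>carrier G. \<forall>m\<in>M. \<forall>a\<in>A. \<forall>n\<in>N. \<forall>x.
        \<phi> (g \<otimes>\<^bsub>G\<^esub> (m \<otimes>\<^bsub>G\<^esub> a \<otimes>\<^bsub>G\<^esub> n)) *v x = \<phi> g *v man_action G A \<sigma> \<mu> m a x)}"

text \<open>The \<open>k\<close>-th component (in \<open>E''\<close>) of the contraction of \<open>\<psi>(g) \<in> V \<otimes> E'\<close> with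
  \<open>\<phi>(g) \<in> (E')\<^sup>\<or> \<otimes> E''\<close>.\<close>

definition contract ::
  "('g \<Rightarrow> complex^'e1^'e2) \<Rightarrow> 'e2 \<Rightarrow> ('g \<Rightarrow> complex^('v \<times> 'e1)) \<Rightarrow> 'g \<Rightarrow> complex^'v" where
  "contract \<phi> k \<psi> g = (\<chi> v. \<Sum>j\<in>UNIV. \<phi> g $ k $ j * \<psi> g $ (v, j))"

text \<open>\<open>\<phi> \<otimes> K\<close> is the transpose of the contraction with \<open>\<phi>\<close>; \<open>\<F>'\<close> is the space of test sections on
  which it is defined.\<close>

definition section_mult ::
  "('g \<Rightarrow> complex^('v \<times> 'e1)) set \<Rightarrow> ('g \<Rightarrow> complex^'e1^'e2) \<Rightarrow>
   (('g \<Rightarrow> complex^'v) \<Rightarrow> complex^'w) \<Rightarrow>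
   ('g \<Rightarrow> complex^('v \<times> 'e1)) \<Rightarrow> complex^('w \<times> 'e2)" where
  "section_mult \<F>' \<phi> K \<psi> =
     (if \<psi> \<in> \<F>' then \<chi> r. K (contract \<phi> (snd r) \<psi>) $ fst r else 0)"

definition transl_section ::
  "('g, 'a::euclidean_space) lie_struct \<Rightarrow> complex^'e^'e2 \<Rightarrow> ('g \<Rightarrow> complex^'e^'e) \<Rightarrow>
   complex^'e1^'e \<Rightarrow> 'g \<Rightarrow> complex^'e1^'e2" where
  "transl_section G p \<tau> i g = (if g \<in> carrier G then p ** \<tau> g ** i else 0)"

end

theory Submission
  imports Defs
begin

text \<open>An intertwining operator \<open>T\<close> is determined by its kernel \<open>K f = (T f)(1)\<close>, because
  \<open>T f h = T (h\<^sup>-\<^sup>1 f) 1\<close>. This gives uniqueness of \<open>\<Phi>\<close>. For existence, write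
  \<open>\<phi>(g) = p \<tau>(h\<^sup>-\<^sup>1) \<tau>(h g) i\<close>: pairing with \<open>g \<mapsto> \<tau>(g) i\<close> sends sections for
  \<open>(\<xi> \<otimes> \<tau>') \<otimes> e\<^bsup>\<lambda> + \<mu>'\<^esup>\<close> to \<open>E\<close>-valued sections for \<open>\<xi> \<otimes> e\<^sup>\<lambda>\<close>, the operator \<open>T\<close> is applied to their
  components, and the result is multiplied by \<open>h \<mapsto> p \<tau>(h\<^sup>-\<^sup>1)\<close>. All three maps are continuous for the
  \<open>C\<^sup>\<infinity>\<close> topologies.\<close>

section \<open>Calculus of smooth functions on relatively open sets\<close>

text \<open>The obstacle is smoothness: for each \<open>h\<close>, evaluating \<phi> \<otimes> K on
  a translate of \<psi> only involves a distribution, and nothing in that formula shows that the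
  result is smooth in \<open>h\<close>. What rescues it is that E is a representation of all of G
  and not just of P: the dependence on \<open>h\<close> can be split off as a smooth matrix
  function, and \<open>T\<close>, which produces smooth functions, sees only the components in E.
  Neither outer map alone commutes with H. Translating by \<open>h\<close> mixes the components by
  \<open>\<tau> h\<close>, and the last factor undoes exactly this. Equivariance of \<open>i\<close>
  is spent on the source, that of \<open>p\<close> on the target, and the shifts by \<rho> are
  carried along unchanged. Continuity of multiplication by a fixed smooth function rests on the
  Leibniz rule: on a compact set, each iterated derivative of the product is bounded by finitely
  many iterated derivatives of the other factor.\<close>

lemma dir_deriv_eq:
  assumes S: "subspace S" and x: "x \<in> S" and v: "v \<in> S"
    and f: "(f has_derivative f') (at x within S)"
  shows "dir_deriv v f x = f' v"
proof -
  \<comment> \<open>The whole line through \<open>x\<close> stays in \<open>S\<close>, so a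
    derivative within \<open>S\<close> restricts to it and determines the two-sided derivative in
    \<open>t\<close> that defines \<open>dir_deriv\<close>.\<close>
  have sub: "range (\<lambda>t. x + t *\<^sub>R v) \<subseteq> S"
    using S x v by (auto simp: subspace_add subspace_scale)
  have g: "((\<lambda>t. x + t *\<^sub>R v) has_derivative (\<lambda>t. t *\<^sub>R v)) (at 0)"
    by (auto intro!: derivative_eq_intros)
  have "(f has_derivative f') (at (x + 0 *\<^sub>R v) within range (\<lambda>t. x + t *\<^sub>R v))"
    using has_derivative_subset[OF f sub] by simp
  from has_derivative_in_compose[OF g this]
  have "((\<lambda>t. f (x + t *\<^sub>R v)) has_derivative (\<lambda>t. f' (t *\<^sub>R v))) (at 0)" .
  moreover have "f' (t *\<^sub>R v) = t *\<^sub>R f' v" for t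
    using f by (simp add: has_derivative_def linear_scale bounded_linear.linear)
  ultimately have "((\<lambda>t. f (x + t *\<^sub>R v)) has_vector_derivative f' v) (at 0)"
    by (simp add: has_vector_derivative_def)
  then show ?thesis
    unfolding dir_deriv_def by (rule vector_derivative_at)
qed

lemma at_within_openin:
  fixes x :: "'a::metric_space"
  assumes "openin (top_of_set S) Y" "x \<in> Y"
  shows "at x within Y = at x within S"
proof -
  obtain T where T: "open T" "Y = S \<inter> T" using assms(1) by (auto simp: openin_open)
  have "x \<in> T" using T assms(2) by auto
  then show ?thesis
    by (rule at_within_nhd[OF _ T(1)]) (use T in auto)
qed

lemma has_derivative_cong_openin:
  assumes X: "openin (top_of_set S) X" and x: "x \<in> X"
    and eq: "\<And>y. y \<in> X \<Longrightarrow> f y = g y"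
    and f: "(f has_derivative f') (at x within S)"
  shows "(g has_derivative f') (at x within S)"
proof -
  obtain d where d: "d > 0" "ball x d \<inter> S \<subseteq> X"
    using X x by (metis openin_contains_ball)
  have "x \<in> S" using X x openin_imp_subset by blast
  have "f y = g y" if "y \<in> S" "dist y x < d" for y
  proof -
    have "y \<in> ball x d \<inter> S" using that by (simp add: dist_commute)
    then have "y \<in> X" using d(2) by blast
    then show ?thesis by (rule eq)
  qed
  then show ?thesis
    by (rule has_derivative_transform_within[OF f d(1) \<open>x \<in> S\<close>])
qed

section \<open>Functions of class C^k\<close>

context
  fixes S X :: "'a::euclidean_space set"
  assumes S: "subspace S" and X: "openin (top_of_set S) X"
begin

lemma dir_deriv_openin_eq:
  assumes "x \<in> X" "v \<in> S" "(f has_derivative f') (at x within S)"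
  shows "dir_deriv v f x = f' v"
  using dir_deriv_eq[OF S _ assms(2,3)] assms(1) openin_imp_subset[OF X] by blast

text \<open>Since \<open>X\<close> is open in \<open>S\<close> and lines in directions of
  \<open>S\<close> stay in \<open>S\<close>, every derivative at a point of \<open>X\<close> depends
  only on values in \<open>X\<close>. The derivatives agree on \<open>X\<close> only, hence the
  induction generalizes both functions.\<close>

lemma Ck_on_cong:
  assumes "Ck_on k S X f" and "\<And>x. x \<in> X \<Longrightarrow> f x = g x"
  shows "Ck_on k S X g"
  using assms
proof (induction k arbitrary: f g)
  case 0
  then show ?case by (simp cong: continuous_on_cong)
next
  case (Suc k)
  have d: "f differentiable (at x within S)" if "x \<in> X" for x
    using Suc.prems(1) that by simp
  have dg: "g differentiable (at x within S) \<and> (\<forall>v\<in>S. dir_deriv v f x = dir_deriv v g x)"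
    if x: "x \<in> X" for x
  proof -
    obtain f' where f': "(f has_derivative f') (at x within S)"
      using d[OF x] by (auto simp: differentiable_def)
    have g': "(g has_derivative f') (at x within S)"
      by (rule has_derivative_cong_openin[OF X x Suc.prems(2) f'])
    show ?thesis
      using dir_deriv_openin_eq[OF x _ f'] dir_deriv_openin_eq[OF x _ g'] g'
      by (auto simp: differentiable_def)
  qed
  show ?case
    using dg Suc.prems(1) by (auto intro: Suc.IH)
qed

lemma Ck_on_Suc_D: "Ck_on (Suc k) S X f \<Longrightarrow> Ck_on k S X f"
proof (induction k arbitrary: f)
  case 0
  have "continuous_on X f"
    unfolding continuous_on_eq_continuous_within
  proof
    fix x assume "x \<in> X"
    then have "f differentiable (at x within S)" using 0 by simp
    then have "continuous (at x within S) f" by (rule differentiable_imp_continuous_within)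
    then show "continuous (at x within X) f"
      by (rule continuous_within_subset) (use X openin_imp_subset in blast)
  qed
  then show ?case by simp
next
  case (Suc k)
  show ?case
    using Suc.prems Suc.IH by auto
qed

text \<open>Allows an explicit derivative in place of \<open>dir_deriv\<close>. The two need not
  agree off \<open>X\<close>, which \<open>Ck_on_cong\<close> absorbs.\<close>

lemma Ck_on_SucI:
  assumes "\<And>x. x \<in> X \<Longrightarrow> (f has_derivative f' x) (at x within S)"
    and "\<And>v. v \<in> S \<Longrightarrow> Ck_on k S X (\<lambda>x. f' x v)"
  shows "Ck_on (Suc k) S X f"
proof -
  have "Ck_on k S X (dir_deriv v f)" if v: "v \<in> S" for v
    by (rule Ck_on_cong[OF assms(2)[OF v]]) (simp add: dir_deriv_openin_eq[OF _ v assms(1)])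
  then show ?thesis using assms(1) by (auto simp: differentiable_def)
qed

lemma Ck_on_SucE:
  assumes "Ck_on (Suc k) S X f"
  obtains f' where "\<And>x. x \<in> X \<Longrightarrow> (f has_derivative f' x) (at x within S)"
    "\<And>v. v \<in> S \<Longrightarrow> Ck_on k S X (\<lambda>x. f' x v)"
    "\<And>x v. x \<in> X \<Longrightarrow> v \<in> S \<Longrightarrow> dir_deriv v f x = f' x v"
proof -
  from assms obtain f' where f': "\<And>x. x \<in> X \<Longrightarrow> (f has_derivative f' x) (at x within S)"
    by (simp add: differentiable_def) metis
  moreover from f' have e: "\<And>x v. x \<in> X \<Longrightarrow> v \<in> S \<Longrightarrow> dir_deriv v f x = f' x v"
    by (simp add: dir_deriv_openin_eq)
  moreover have "Ck_on k S X (\<lambda>x. f' x v)" if "v \<in> S" for v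
    by (rule Ck_on_cong[where f = "dir_deriv v f"]) (use assms that e in auto)
  ultimately show ?thesis using that by blast
qed

lemma Ck_on_add:
  assumes "Ck_on k S X f" "Ck_on k S X g"
  shows "Ck_on k S X (\<lambda>x. f x + g x)"
  using assms
proof (induction k arbitrary: f g)
  case 0
  then show ?case by (simp add: continuous_on_add)
next
  case (Suc k)
  obtain f' where f': "\<And>x. x \<in> X \<Longrightarrow> (f has_derivative f' x) (at x within S)"
    "\<And>v. v \<in> S \<Longrightarrow> Ck_on k S X (\<lambda>x. f' x v)" using Ck_on_SucE[OF Suc.prems(1)] by metis
  obtain g' where g': "\<And>x. x \<in> X \<Longrightarrow> (g has_derivative g' x) (at x within S)"
    "\<And>v. v \<in> S \<Longrightarrow> Ck_on k S X (\<lambda>x. g' x v)" using Ck_on_SucE[OF Suc.prems(2)] by metis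
  show ?case
    by (rule Ck_on_SucI[where f' = "\<lambda>x v. f' x v + g' x v"])
      (use f' g' Suc.IH in \<open>auto intro: has_derivative_add\<close>)
qed

lemma Ck_on_const: "Ck_on k S X (\<lambda>x. c)"
proof (induction k arbitrary: c)
  case (Suc k)
  show ?case
    by (rule Ck_on_SucI[where f' = "\<lambda>x v. 0"]) (use Suc in auto)
qed simp

lemma Ck_on_sum:
  "(\<And>i. i \<in> I \<Longrightarrow> Ck_on k S X (f i)) \<Longrightarrow> Ck_on k S X (\<lambda>x. \<Sum>i\<in>I. f i x)"
  by (induction I rule: infinite_finite_induct) (simp_all add: Ck_on_const Ck_on_add)

lemma Ck_on_bilinear:
  assumes "bounded_bilinear B" "Ck_on k S X f" "Ck_on k S X g"
  shows "Ck_on k S X (\<lambda>x. B (f x) (g x))"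
  using assms(2,3)
proof (induction k arbitrary: f g)
  case 0
  then show ?case by (simp add: bounded_bilinear.continuous_on[OF assms(1)])
next
  case (Suc k)
  \<comment> \<open>The product rule leaves one factor undifferentiated in each term, so
    \<open>f\<close> and \<open>g\<close> themselves are needed at order \<open>k\<close>.\<close>
  note fk = Ck_on_Suc_D[OF Suc.prems(1)] and gk = Ck_on_Suc_D[OF Suc.prems(2)]
  obtain f' where f': "\<And>x. x \<in> X \<Longrightarrow> (f has_derivative f' x) (at x within S)"
    "\<And>v. v \<in> S \<Longrightarrow> Ck_on k S X (\<lambda>x. f' x v)" using Ck_on_SucE[OF Suc.prems(1)] by metis
  obtain g' where g': "\<And>x. x \<in> X \<Longrightarrow> (g has_derivative g' x) (at x within S)"
    "\<And>v. v \<in> S \<Longrightarrow> Ck_on k S X (\<lambda>x. g' x v)" using Ck_on_SucE[OF Suc.prems(2)] by metis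
  show ?case
  proof (rule Ck_on_SucI[where f' = "\<lambda>x v. B (f x) (g' x v) + B (f' x v) (g x)"])
    show "((\<lambda>x. B (f x) (g x)) has_derivative (\<lambda>v. B (f x) (g' x v) + B (f' x v) (g x)))
       (at x within S)" if "x \<in> X" for x
      using bounded_bilinear.FDERIV[OF assms(1) f'(1)[OF that] g'(1)[OF that]] .
    show "Ck_on k S X (\<lambda>x. B (f x) (g' x v) + B (f' x v) (g x))" if "v \<in> S" for v
      by (rule Ck_on_add; rule Suc.IH) (use f' g' fk gk that in auto)
  qed
qed

lemma Ck_on_linear:
  assumes "bounded_linear l" "Ck_on k S X f"
  shows "Ck_on k S X (\<lambda>x. l (f x))"
proof -
  \<comment> \<open>A linear map is treated as a product whose scalar factor is the constant
    1.\<close>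
  have "bounded_bilinear (\<lambda>(r::real) y. r *\<^sub>R l y)"
    by (rule bounded_bilinear.comp[OF bounded_bilinear_scaleR bounded_linear_ident assms(1)])
  from Ck_on_bilinear[OF this Ck_on_const[of _ 1] assms(2)] show ?thesis by simp
qed

lemma Ck_on_local:
  assumes "\<And>x. x \<in> X \<Longrightarrow> \<exists>Y. openin (top_of_set S) Y \<and> x \<in> Y \<and> Ck_on k S Y f"
  shows "Ck_on k S X f"
  using assms
proof (induction k arbitrary: f)
  case 0
  have "continuous_on X f"
    unfolding continuous_on_eq_continuous_within
  proof
    fix x assume x: "x \<in> X"
    then obtain Y where Y: "openin (top_of_set S) Y" "x \<in> Y" "continuous_on Y f"
      using 0 by auto
    then have "continuous (at x within Y) f"
      by (simp add: continuous_on_eq_continuous_within)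
    then have "continuous (at x within S) f"
      unfolding continuous_within at_within_openin[OF Y(1,2)] .
    then show "continuous (at x within X) f"
      by (rule continuous_within_subset) (use X openin_imp_subset in blast)
  qed
  then show ?case by simp
next
  case (Suc k)
  show ?case
    unfolding Ck_on.simps
  proof (intro conjI ballI)
    show "f differentiable (at x within S)" if "x \<in> X" for x
      using Suc.prems[OF that] by auto
    show "Ck_on k S X (dir_deriv v f)" if v: "v \<in> S" for v
    proof (rule Suc.IH)
      fix x assume "x \<in> X"
      from Suc.prems[OF this] v
      show "\<exists>Y. openin (top_of_set S) Y \<and> x \<in> Y \<and> Ck_on k S Y (dir_deriv v f)"
        by auto
    qed
  qed
qed

text \<open>On \<open>X\<close> the function equals its own expansion in \<open>B\<close>.
  Differentiating that linear expansion and comparing along \<open>v\<close>, where the derivative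
  within \<open>S\<close> is unique, shows that \<open>f' v\<close> is reproduced as well.\<close>

lemma derivative_in_subspace:
  fixes f :: "'a \<Rightarrow> 'c::euclidean_space"
  assumes B: "\<And>y. y \<in> S' \<Longrightarrow> (\<Sum>b\<in>B. (y \<bullet> b) *\<^sub>R b) = y" and f: "f ` X \<subseteq> S'"
    and x: "x \<in> X" and v: "v \<in> S" and f': "(f has_derivative f') (at x within S)"
  shows "(\<Sum>b\<in>B. (f' v \<bullet> b) *\<^sub>R b) = f' v"
proof -
  have "((\<lambda>x. \<Sum>b\<in>B. (f x \<bullet> b) *\<^sub>R b) has_derivative (\<lambda>v. \<Sum>b\<in>B. (f' v \<bullet> b) *\<^sub>R b)) (at x within S)"
    by (intro derivative_intros f')
  then have "(f has_derivative (\<lambda>v. \<Sum>b\<in>B. (f' v \<bullet> b) *\<^sub>R b)) (at x within S)"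
    by (rule has_derivative_cong_openin[OF X x, rotated]) (use f B in blast)
  from dir_deriv_openin_eq[OF x v this] dir_deriv_openin_eq[OF x v f'] show ?thesis by simp
qed

text \<open>The chain rule produces \<open>g' (f x) (f' x v)\<close>, but smoothness of
  \<open>g\<close> speaks only of derivatives in fixed directions. Expanding \<open>f' x v\<close>
  in an orthonormal basis of \<open>S'\<close> gives coefficients that are inner products, hence of
  class C^k, times fixed-direction derivatives of \<open>g\<close> composed with \<open>f\<close>,
  to which the induction hypothesis applies.\<close>

lemma Ck_on_compose:
  fixes f :: "'a \<Rightarrow> 'c::euclidean_space"
  assumes S': "subspace S'" and Y: "Y \<subseteq> S'" and fX: "f ` X \<subseteq> Y"
    and "Ck_on k S X f" "Ck_on k S' Y g"
  shows "Ck_on k S X (\<lambda>x. g (f x))"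
  using assms(4,5)
proof (induction k arbitrary: g)
  case 0
  then show ?case using continuous_on_compose2[of Y g X f] fX by simp
next
  case (Suc k)
  obtain B where B: "B \<subseteq> S'" "pairwise orthogonal B" "\<And>x. x \<in> B \<Longrightarrow> norm x = 1"
    "independent B" "span B = S'"
    using orthonormal_basis_subspace[OF S'] by metis
  have finB: "finite B" using B(4) independent_imp_finite by blast
  have expand: "(\<Sum>b\<in>B. (y \<bullet> b) *\<^sub>R b) = y" if "y \<in> S'" for y
    using orthonormal_basis_expand[OF B(2,3) _ finB, of y] that B(5) by blast
  obtain f' where f': "\<And>x. x \<in> X \<Longrightarrow> (f has_derivative f' x) (at x within S)"
    "\<And>v. v \<in> S \<Longrightarrow> Ck_on k S X (\<lambda>x. f' x v)" using Ck_on_SucE[OF Suc.prems(1)] by metis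
  obtain g' where g': "\<And>y. y \<in> Y \<Longrightarrow> (g has_derivative g' y) (at y within S')"
    using Suc.prems(2) by (simp add: differentiable_def) metis
  have dg: "dir_deriv b g y = g' y b" if "y \<in> Y" "b \<in> B" for y b
    by (rule dir_deriv_eq[OF S' _ _ g']) (use that Y B in auto)
  show ?case
  proof (rule Ck_on_SucI[where f' = "\<lambda>x v. g' (f x) (f' x v)"])
    show "((\<lambda>x. g (f x)) has_derivative (\<lambda>v. g' (f x) (f' x v))) (at x within S)"
      if x: "x \<in> X" for x
    proof -
      have "(f has_derivative f' x) (at x within X)"
        using f'(1)[OF x] at_within_openin[OF X x] by simp
      moreover have "(g has_derivative g' (f x)) (at (f x) within f ` X)"
        by (rule has_derivative_subset[OF g']) (use fX Y x in auto)
      ultimately show ?thesis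
        using has_derivative_in_compose at_within_openin[OF X x] by metis
    qed
    show "Ck_on k S X (\<lambda>x. g' (f x) (f' x v))" if v: "v \<in> S" for v
    proof (rule Ck_on_cong[where f = "\<lambda>x. \<Sum>b\<in>B. (f' x v \<bullet> b) *\<^sub>R dir_deriv b g (f x)"])
      show "Ck_on k S X (\<lambda>x. \<Sum>b\<in>B. (f' x v \<bullet> b) *\<^sub>R dir_deriv b g (f x))"
      proof (rule Ck_on_sum, rule Ck_on_bilinear[OF bounded_bilinear_scaleR])
        fix b assume "b \<in> B"
        show "Ck_on k S X (\<lambda>x. f' x v \<bullet> b)"
          by (rule Ck_on_linear[OF bounded_linear_inner_left f'(2)[OF v]])
        show "Ck_on k S X (\<lambda>x. dir_deriv b g (f x))"
          by (rule Suc.IH) (use Suc.prems \<open>b \<in> B\<close> B Ck_on_Suc_D in auto)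
      qed
      fix x assume x: "x \<in> X"
      then have fx: "f x \<in> Y" using fX by auto
      have lin: "linear (g' (f x))"
        using g'[OF fx] has_derivative_bounded_linear bounded_linear.linear by blast
      have "g' (f x) (f' x v) = g' (f x) (\<Sum>b\<in>B. (f' x v \<bullet> b) *\<^sub>R b)"
        using derivative_in_subspace[OF expand _ x v f'(1)[OF x]] fX Y by auto
      then show "(\<Sum>b\<in>B. (f' x v \<bullet> b) *\<^sub>R dir_deriv b g (f x)) = g' (f x) (f' x v)"
        by (simp add: linear_sum[OF lin] linear_scale[OF lin] dg[OF fx])
    qed
  qed
qed

end

section \<open>Smooth functions and iterated directional derivatives\<close>

context
  fixes S X :: "'a::euclidean_space set"
  assumes S: "subspace S" and X: "openin (top_of_set S) X"
begin

lemma Cinf_on_cong: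
  "Cinf_on S X f \<Longrightarrow> (\<And>x. x \<in> X \<Longrightarrow> f x = g x) \<Longrightarrow> Cinf_on S X g"
  unfolding Cinf_on_def by (intro allI) (rule Ck_on_cong[OF S X, where f = f], auto)

lemma Cinf_on_const: "Cinf_on S X (\<lambda>x. c)"
  by (simp add: Cinf_on_def Ck_on_const[OF S X])

lemma Cinf_on_add: "Cinf_on S X f \<Longrightarrow> Cinf_on S X g \<Longrightarrow> Cinf_on S X (\<lambda>x. f x + g x)"
  by (simp add: Cinf_on_def Ck_on_add[OF S X])

lemma Cinf_on_linear: "bounded_linear l \<Longrightarrow> Cinf_on S X f \<Longrightarrow> Cinf_on S X (\<lambda>x. l (f x))"
  by (simp add: Cinf_on_def Ck_on_linear[OF S X])

lemma Cinf_on_bilinear: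
  "bounded_bilinear B \<Longrightarrow> Cinf_on S X f \<Longrightarrow> Cinf_on S X g \<Longrightarrow> Cinf_on S X (\<lambda>x. B (f x) (g x))"
  by (simp add: Cinf_on_def Ck_on_bilinear[OF S X])

lemma Cinf_on_compose:
  fixes f :: "'a \<Rightarrow> 'c::euclidean_space"
  assumes "subspace S'" "Y \<subseteq> S'" "f ` X \<subseteq> Y" "Cinf_on S X f" "Cinf_on S' Y g"
  shows "Cinf_on S X (\<lambda>x. g (f x))"
  unfolding Cinf_on_def
  by (intro allI, rule Ck_on_compose[OF S X assms(1-3)]) (use assms(4,5) in \<open>auto simp: Cinf_on_def\<close>)

lemma Cinf_on_local:
  assumes "\<And>x. x \<in> X \<Longrightarrow> \<exists>Y. openin (top_of_set S) Y \<and> x \<in> Y \<and> Cinf_on S Y f"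
  shows "Cinf_on S X f"
  unfolding Cinf_on_def
proof
  show "Ck_on k S X f" for k
    by (rule Ck_on_local[OF S X]) (use assms in \<open>simp add: Cinf_on_def, meson\<close>)
qed

lemma Cinf_on_continuous: "Cinf_on S X f \<Longrightarrow> continuous_on X f"
  unfolding Cinf_on_def Ck_on.simps(1)[of S, symmetric] by simp

lemma Cinf_on_dir_deriv:
  assumes "Cinf_on S X f" "v \<in> S"
  shows "Cinf_on S X (dir_deriv v f)"
  unfolding Cinf_on_def
proof
  fix k
  have "Ck_on (Suc k) S X f" using assms(1) by (simp only: Cinf_on_def)
  then show "Ck_on k S X (dir_deriv v f)" using assms(2) by simp
qed

lemma Cinf_on_foldr: "Cinf_on S X f \<Longrightarrow> set vs \<subseteq> S \<Longrightarrow> Cinf_on S X (foldr dir_deriv vs f)"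
  by (induction vs) (auto intro: Cinf_on_dir_deriv)

lemma Cinf_onE:
  assumes "Cinf_on S X f"
  obtains f' where "\<And>x. x \<in> X \<Longrightarrow> (f has_derivative f' x) (at x within S)"
proof -
  have "Ck_on (Suc 0) S X f" using assms by (simp only: Cinf_on_def)
  then show ?thesis by (rule Ck_on_SucE[OF S X]) (rule that)
qed

lemma dir_deriv_cong:
  assumes "Cinf_on S X f" "v \<in> S" "x \<in> X" "\<And>y. y \<in> X \<Longrightarrow> f y = g y"
  shows "dir_deriv v f x = dir_deriv v g x"
proof -
  obtain f' where f': "(f has_derivative f' x) (at x within S)"
    using Cinf_onE[OF assms(1)] assms(3) by blast
  show ?thesis
    using dir_deriv_openin_eq[OF S X assms(3,2) f']
      dir_deriv_openin_eq[OF S X assms(3,2) has_derivative_cong_openin[OF X assms(3,4) f']] by simp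
qed

lemma foldr_dir_deriv_cong:
  assumes "Cinf_on S X f" "set vs \<subseteq> S" "x \<in> X" "\<And>y. y \<in> X \<Longrightarrow> f y = g y"
  shows "foldr dir_deriv vs f x = foldr dir_deriv vs g x"
  using assms(2,3)
proof (induction vs arbitrary: x)
  case (Cons v vs)
  have "dir_deriv v (foldr dir_deriv vs f) x = dir_deriv v (foldr dir_deriv vs g) x"
    by (rule dir_deriv_cong[OF Cinf_on_foldr[OF assms(1)]]) (use Cons in auto)
  then show ?case by simp
qed (simp add: assms(4))

lemma dir_deriv_add:
  assumes "Cinf_on S X f" "Cinf_on S X g" "v \<in> S" "x \<in> X"
  shows "dir_deriv v (\<lambda>x. f x + g x) x = dir_deriv v f x + dir_deriv v g x"
proof -
  obtain f' where f': "(f has_derivative f' x) (at x within S)"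
    using Cinf_onE[OF assms(1)] assms(4) by blast
  obtain g' where g': "(g has_derivative g' x) (at x within S)"
    using Cinf_onE[OF assms(2)] assms(4) by blast
  note eq = dir_deriv_openin_eq[OF S X assms(4,3)]
  show ?thesis
    unfolding eq[OF f'] eq[OF g'] by (rule eq[OF has_derivative_add[OF f' g']])
qed

lemma foldr_dir_deriv_add:
  assumes "Cinf_on S X f" "Cinf_on S X g" "set vs \<subseteq> S" "x \<in> X"
  shows "foldr dir_deriv vs (\<lambda>x. f x + g x) x = foldr dir_deriv vs f x + foldr dir_deriv vs g x"
  using assms(3,4)
proof (induction vs arbitrary: x)
  case (Cons v vs)
  have vs: "set vs \<subseteq> S" "v \<in> S" using Cons by auto
  have "dir_deriv v (foldr dir_deriv vs (\<lambda>x. f x + g x)) x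
      = dir_deriv v (\<lambda>x. foldr dir_deriv vs f x + foldr dir_deriv vs g x) x"
    by (rule dir_deriv_cong[OF Cinf_on_foldr[OF Cinf_on_add]]) (use Cons assms in auto)
  also have "\<dots> = dir_deriv v (foldr dir_deriv vs f) x + dir_deriv v (foldr dir_deriv vs g) x"
    by (rule dir_deriv_add) (use Cons vs assms in \<open>auto intro: Cinf_on_foldr\<close>)
  finally show ?case by simp
qed simp

lemma dir_deriv_bilinear:
  assumes "bounded_bilinear B" "Cinf_on S X f" "Cinf_on S X g" "v \<in> S" "x \<in> X"
  shows "dir_deriv v (\<lambda>x. B (f x) (g x)) x = B (f x) (dir_deriv v g x) + B (dir_deriv v f x) (g x)"
proof -
  obtain f' where f': "(f has_derivative f' x) (at x within S)"
    using Cinf_onE[OF assms(2)] assms(5) by blast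
  obtain g' where g': "(g has_derivative g' x) (at x within S)"
    using Cinf_onE[OF assms(3)] assms(5) by blast
  note eq = dir_deriv_openin_eq[OF S X assms(5,4)]
  show ?thesis
    unfolding eq[OF f'] eq[OF g'] by (rule eq[OF bounded_bilinear.FDERIV[OF assms(1) f' g']])
qed

text \<open>The Leibniz rule as a seminorm estimate: \<open>W\<close> and \<open>M\<close> depend on
  \<open>f\<close>, \<open>C\<close> and \<open>vs\<close>, but not on \<open>g\<close>.
  \<open>foldr\<close> applies the last direction of the list first, so the induction runs from the
  right: the product rule for the innermost derivative leaves two products of smooth functions, and
  the hypothesis is used for both \<open>f\<close> and \<open>dir_deriv v f\<close>.\<close>

lemma foldr_bilinear_bound:
  assumes B: "bounded_bilinear B" and C: "compact C" "C \<subseteq> X"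
    and "set vs \<subseteq> S" "Cinf_on S X f"
  shows "\<exists>W M. finite W \<and> M \<ge> 0 \<and> (\<forall>ws\<in>W. set ws \<subseteq> S) \<and>
    (\<forall>g. Cinf_on S X g \<longrightarrow> (\<forall>x\<in>C. norm (foldr dir_deriv vs (\<lambda>x. B (f x) (g x)) x)
        \<le> M * (\<Sum>ws\<in>W. norm (foldr dir_deriv ws g x))))"
  using assms(4,5)
proof (induction vs arbitrary: f rule: rev_induct)
  \<comment> \<open>Order zero: \<open>M\<close> is the bound \<open>R\<close> of \<open>f\<close>
    on the compact set times the bound \<open>K\<close> of \<open>B\<close>.\<close>
  case Nil
  obtain K where K: "K > 0" "\<And>a b. norm (B a b) \<le> norm a * norm b * K"
    using bounded_bilinear.pos_bounded[OF B] by blast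
  have "compact (f ` C)"
    by (rule compact_continuous_image[OF continuous_on_subset[OF Cinf_on_continuous[OF Nil(2)] C(2)] C(1)])
  then have "bounded (f ` C)" by (rule compact_imp_bounded)
  then obtain R where R: "R > 0" "\<And>x. x \<in> C \<Longrightarrow> norm (f x) \<le> R"
    unfolding bounded_pos by blast
  have "norm (B (f x) (g x)) \<le> (R * K) * norm (g x)" if "x \<in> C" for x g
  proof -
    have "norm (B (f x) (g x)) \<le> norm (f x) * norm (g x) * K" by (rule K(2))
    also have "\<dots> \<le> R * norm (g x) * K"
      using R(2)[OF that] K(1) by (intro mult_right_mono) auto
    finally show ?thesis by (simp add: mult_ac)
  qed
  then show ?case
    using R(1) K(1) by (intro exI[of _ "{[]}"] exI[of _ "R * K"]) auto
next
  case (snoc v vs)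
  have v: "v \<in> S" "set vs \<subseteq> S" using snoc.prems by auto
  have df: "Cinf_on S X (dir_deriv v f)" by (rule Cinf_on_dir_deriv[OF snoc.prems(2) v(1)])
  obtain W1 M1 where 1: "finite W1" "M1 \<ge> 0" "\<forall>ws\<in>W1. set ws \<subseteq> S"
    "\<forall>g. Cinf_on S X g \<longrightarrow> (\<forall>x\<in>C. norm (foldr dir_deriv vs (\<lambda>x. B (f x) (g x)) x)
        \<le> M1 * (\<Sum>ws\<in>W1. norm (foldr dir_deriv ws g x)))"
    using snoc.IH[OF v(2) snoc.prems(2)] by (elim exE conjE) (rule that)
  obtain W2 M2 where 2: "finite W2" "M2 \<ge> 0" "\<forall>ws\<in>W2. set ws \<subseteq> S"
    "\<forall>g. Cinf_on S X g \<longrightarrow> (\<forall>x\<in>C. norm (foldr dir_deriv vs (\<lambda>x. B (dir_deriv v f x) (g x)) x)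
        \<le> M2 * (\<Sum>ws\<in>W2. norm (foldr dir_deriv ws g x)))"
    using snoc.IH[OF v(2) df] by (elim exE conjE) (rule that)
  \<comment> \<open>Appending \<open>v\<close> records the case in which the innermost derivative
    falls on \<open>g\<close>; the words in \<open>W2\<close> belong to the case in which it falls
    on \<open>f\<close>.\<close>
  let ?W1 = "(\<lambda>ws. ws @ [v]) ` W1"
  let ?W = "?W1 \<union> W2"
  show ?case
  proof (intro exI[of _ ?W] exI[of _ "M1 + M2"] conjI allI impI ballI)
    show "finite ?W" "M1 + M2 \<ge> 0" using 1(1,2) 2(1,2) by auto
    show "\<And>ws. ws \<in> ?W \<Longrightarrow> set ws \<subseteq> S" using 1(3) 2(3) v by (fastforce simp del: Ball_def)
    fix g :: "'a \<Rightarrow> 'c" and x assume g: "Cinf_on S X g" and x: "x \<in> C"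
    have xX: "x \<in> X" using x C by auto
    have dg: "Cinf_on S X (dir_deriv v g)" by (rule Cinf_on_dir_deriv[OF g v(1)])
    let ?s = "\<lambda>W. \<Sum>ws\<in>W. norm (foldr dir_deriv ws g x)"
    have s0: "?s U \<ge> 0" for U by (simp add: sum_nonneg)
    have "foldr dir_deriv (vs @ [v]) (\<lambda>x. B (f x) (g x)) x
      = foldr dir_deriv vs (\<lambda>x. B (f x) (dir_deriv v g x) + B (dir_deriv v f x) (g x)) x"
      unfolding foldr_append foldr.simps comp_apply id_apply
      by (rule foldr_dir_deriv_cong[OF Cinf_on_dir_deriv[OF Cinf_on_bilinear[OF B snoc.prems(2) g] v(1)]
            v(2) xX dir_deriv_bilinear[OF B snoc.prems(2) g v(1)]])
    also have "\<dots> = foldr dir_deriv vs (\<lambda>x. B (f x) (dir_deriv v g x)) x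
        + foldr dir_deriv vs (\<lambda>x. B (dir_deriv v f x) (g x)) x"
      by (rule foldr_dir_deriv_add[OF Cinf_on_bilinear[OF B snoc.prems(2) dg]
            Cinf_on_bilinear[OF B df g] v(2) xX])
    finally have "norm (foldr dir_deriv (vs @ [v]) (\<lambda>x. B (f x) (g x)) x)
      \<le> norm (foldr dir_deriv vs (\<lambda>x. B (f x) (dir_deriv v g x)) x)
        + norm (foldr dir_deriv vs (\<lambda>x. B (dir_deriv v f x) (g x)) x)"
      by (simp add: norm_triangle_ineq)
    also have "\<dots> \<le> M1 * ?s ?W1 + M2 * ?s W2"
    proof (rule add_mono)
      have "?s ?W1 = (\<Sum>ws\<in>W1. norm (foldr dir_deriv ws (dir_deriv v g) x))"
        by (subst sum.reindex) (simp_all add: inj_on_def)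
      then show "norm (foldr dir_deriv vs (\<lambda>x. B (f x) (dir_deriv v g x)) x) \<le> M1 * ?s ?W1"
        using 1(4)[rule_format, OF dg x] by metis
    qed (rule 2(4)[rule_format, OF g x])
    \<comment> \<open>The two sets of words may overlap, so each sum is enlarged to the union
      separately and the constants are added.\<close>
    also have "\<dots> \<le> M1 * ?s ?W + M2 * ?s ?W"
      by (rule add_mono; rule mult_left_mono[OF sum_mono2]) (use 1(1,2) 2(1,2) in auto)
    finally show "norm (foldr dir_deriv (vs @ [v]) (\<lambda>x. B (f x) (g x)) x) \<le> (M1 + M2) * ?s ?W"
      by (simp add: distrib_right)
  qed
qed

end

section \<open>Smooth functions on Lie groups\<close>

context lie_group
begin

lemma chart_subset: "(U, c) \<in> charts L \<Longrightarrow> U \<subseteq> carrier L"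
  using chart openin_subset topspace_eq by metis

lemma chart_inj:
  assumes "(U, c) \<in> charts L"
  shows "inj_on c U"
proof -
  have "homeomorphic_map (subtopology (topo L) U) (top_of_set (c ` U)) c"
    using chart[OF assms] by blast
  from homeomorphic_imp_injective_map[OF this] show ?thesis
    using chart_subset[OF assms] by (simp add: topspace_subtopology topspace_eq Int_absorb1)
qed

lemma chart_inv: "(U, c) \<in> charts L \<Longrightarrow> x \<in> U \<Longrightarrow> inv_into U c (c x) = x"
  using chart_inj by simp

lemma chart_openin:
  assumes c: "(U, c) \<in> charts L" and V: "openin (topo L) V"
  shows "openin (top_of_set (model L)) (c ` (U \<inter> V))"
proof -
  have "homeomorphic_map (subtopology (topo L) U) (top_of_set (c ` U)) c"
    and op: "openin (top_of_set (model L)) (c ` U)" using chart[OF c] by auto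
  moreover have "openin (subtopology (topo L) U) (U \<inter> V)"
    using V by (simp add: openin_subtopology_Int2)
  ultimately have "openin (top_of_set (c ` U)) (c ` (U \<inter> V))"
    using homeomorphic_map_openness_eq by blast
  then show ?thesis using op openin_trans by blast
qed

lemma chart_at:
  assumes "x \<in> carrier L" obtains U c where "(U, c) \<in> charts L" "x \<in> U"
  using charts_cover assms by blast

lemma smooth_funD: "smooth_fun L (carrier L) f \<Longrightarrow> (U, c) \<in> charts L \<Longrightarrow>
    Cinf_on (model L) (c ` U) (f \<circ> inv_into U c)"
  using chart_subset[of U c] by (auto simp: smooth_fun_def Int_absorb2 dest!: bspec)

lemma smooth_funI:
  assumes "\<And>U c. (U, c) \<in> charts L \<Longrightarrow> Cinf_on (model L) (c ` U) (f \<circ> inv_into U c)"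
  shows "smooth_fun L (carrier L) f"
proof -
  have "Cinf_on (model L) (c ` (U \<inter> carrier L)) (f \<circ> inv_into U c)" if "(U, c) \<in> charts L" for U c
    using assms[OF that] chart_subset[OF that] by (simp add: Int_absorb2)
  then show ?thesis by (auto simp: smooth_fun_def)
qed

lemma chart_image_open: "(U, c) \<in> charts L \<Longrightarrow> openin (top_of_set (model L)) (c ` U)"
  using chart by blast

lemma smooth_fun_cong:
  assumes "smooth_fun L (carrier L) f" "\<And>x. x \<in> carrier L \<Longrightarrow> f x = g x"
  shows "smooth_fun L (carrier L) g"
proof (rule smooth_funI)
  fix U c assume c: "(U, c) \<in> charts L"
  show "Cinf_on (model L) (c ` U) (g \<circ> inv_into U c)"
    by (rule Cinf_on_cong[OF subspace_model chart_image_open[OF c] smooth_funD[OF assms(1) c]])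
      (use assms(2) chart_subset[OF c] in \<open>auto simp: chart_inv[OF c]\<close>)
qed

lemma smooth_fun_add:
  assumes "smooth_fun L (carrier L) f" "smooth_fun L (carrier L) g"
  shows "smooth_fun L (carrier L) (\<lambda>x. f x + g x)"
  using Cinf_on_add[OF subspace_model chart_image_open smooth_funD[OF assms(1)] smooth_funD[OF assms(2)]]
  by (intro smooth_funI) (simp add: o_def)

lemma smooth_fun_linear:
  assumes "bounded_linear l" "smooth_fun L (carrier L) f"
  shows "smooth_fun L (carrier L) (\<lambda>x. l (f x))"
  using Cinf_on_linear[OF subspace_model chart_image_open assms(1) smooth_funD[OF assms(2)]]
  by (intro smooth_funI) (simp add: o_def)

lemma smooth_fun_bilinear:
  assumes "bounded_bilinear B" "smooth_fun L (carrier L) f" "smooth_fun L (carrier L) g"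
  shows "smooth_fun L (carrier L) (\<lambda>x. B (f x) (g x))"
  using Cinf_on_bilinear[OF subspace_model chart_image_open assms(1) smooth_funD[OF assms(2)]
      smooth_funD[OF assms(3)]]
  by (intro smooth_funI) (simp add: o_def)

lemma smooth_fun_const: "smooth_fun L (carrier L) (\<lambda>x. c)"
  using Cinf_on_const[OF subspace_model chart_image_open]
  by (intro smooth_funI) (simp add: o_def)

lemma smooth_fun_sum:
  "(\<And>i. i \<in> I \<Longrightarrow> smooth_fun L (carrier L) (f i)) \<Longrightarrow> smooth_fun L (carrier L) (\<lambda>x. \<Sum>i\<in>I. f i x)"
  by (induction I rule: infinite_finite_induct) (simp_all add: smooth_fun_const smooth_fun_add)

text \<open>On an open subset of the group a local extension coincides with \<open>f\<close>, and
  smoothness in a chart is local. This turns the notion used in \<open>fin_rep\<close> into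
  \<open>smooth_fun\<close> for representations of the whole group.\<close>

lemma smooth_on_subset_carrier:
  assumes "smooth_on_subset L (carrier L) f"
  shows "smooth_fun L (carrier L) f"
proof (rule smooth_funI)
  fix U c assume c: "(U, c) \<in> charts L"
  show "Cinf_on (model L) (c ` U) (f \<circ> inv_into U c)"
  proof (rule Cinf_on_local[OF subspace_model chart_image_open[OF c]])
    fix s assume "s \<in> c ` U"
    then obtain x where x: "x \<in> U" "s = c x" by auto
    then obtain V f' where V: "openin (topo L) V" "x \<in> V" "smooth_fun L V f'"
      "\<And>y. y \<in> V \<inter> carrier L \<Longrightarrow> f' y = f y"
      using assms chart_subset[OF c] unfolding smooth_on_subset_def by (meson subsetD)
    have "Cinf_on (model L) (c ` (U \<inter> V)) (f' \<circ> inv_into U c)"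
      using V(3) c by (auto simp: smooth_fun_def dest!: bspec)
    then have "Cinf_on (model L) (c ` (U \<inter> V)) (f \<circ> inv_into U c)"
      by (rule Cinf_on_cong[OF subspace_model chart_openin[OF c V(1)]])
        (use V(4) chart_subset[OF c] in \<open>auto simp: chart_inv[OF c]\<close>)
    then show "\<exists>Y. openin (top_of_set (model L)) Y \<and> s \<in> Y \<and> Cinf_on (model L) Y (f \<circ> inv_into U c)"
      using chart_openin[OF c V(1)] x V(2) by blast
  qed
qed

lemma smooth_fun_compose:
  fixes L' :: "('h, 'b::euclidean_space) lie_struct"
  assumes L': "lie_group L'" and f: "smooth_map L L' f" and g: "smooth_fun L' (carrier L') g"
  shows "smooth_fun L (carrier L) (\<lambda>x. g (f x))"
proof (rule smooth_funI)
  interpret L': lie_group L' by (rule L')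
  have cont: "continuous_map (topo L) (topo L') f" using f by (simp add: smooth_map_def)
  fix U c assume c: "(U, c) \<in> charts L"
  show "Cinf_on (model L) (c ` U) ((\<lambda>x. g (f x)) \<circ> inv_into U c)"
  proof (rule Cinf_on_local[OF subspace_model chart_image_open[OF c]])
    fix s assume "s \<in> c ` U"
    then obtain x where x: "x \<in> U" "s = c x" by auto
    then have "f x \<in> carrier L'"
      using cont chart_subset[OF c] by (auto simp: continuous_map_def topspace_eq L'.topspace_eq)
    then obtain U' c' where c': "(U', c') \<in> charts L'" "f x \<in> U'" by (rule L'.chart_at)
    \<comment> \<open>By continuity the preimage of a chart domain is open; there the map factors as
      \<open>g\<close> in the target chart after \<open>f\<close> in the two charts.\<close>
    let ?V = "{x \<in> topspace (topo L). f x \<in> U'}"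
    have V: "openin (topo L) ?V"
      using cont L'.chart[OF c'(1)] by (simp add: openin_continuous_map_preimage)
    have eq: "U \<inter> ?V = {x \<in> U. f x \<in> U'}" using chart_subset[OF c] topspace_eq by auto
    have Yo: "openin (top_of_set (model L)) (c ` {x \<in> U. f x \<in> U'})" (is "openin _ ?Y")
      using chart_openin[OF c V] eq by simp
    have fY: "Cinf_on (model L) ?Y (c' \<circ> f \<circ> inv_into U c)"
      using f c c'(1) by (auto simp: smooth_map_def dest!: bspec)
    have "Cinf_on (model L) ?Y (\<lambda>x. (g \<circ> inv_into U' c') ((c' \<circ> f \<circ> inv_into U c) x))"
      by (rule Cinf_on_compose[OF subspace_model Yo L'.subspace_model
            openin_imp_subset[OF L'.chart_image_open[OF c'(1)]] _ fY L'.smooth_funD[OF g c'(1)]])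
        (auto simp: chart_inv[OF c])
    then have "Cinf_on (model L) ?Y ((\<lambda>x. g (f x)) \<circ> inv_into U c)"
      by (rule Cinf_on_cong[OF subspace_model Yo]) (auto simp: chart_inv[OF c] L'.chart_inv[OF c'(1)])
    then show "\<exists>Y. openin (top_of_set (model L)) Y \<and> s \<in> Y \<and>
        Cinf_on (model L) Y ((\<lambda>x. g (f x)) \<circ> inv_into U c)"
      using Yo x c'(2) by blast
  qed
qed

text \<open>Left multiplication is the joint multiplication restricted to the slice with first
  coordinate \<open>c1 h\<close>, that is, composed with the affine embedding
  \<open>t \<mapsto> (c1 h, t)\<close>.\<close>

lemma smooth_map_left_mult:
  assumes h: "h \<in> carrier L"
  shows "smooth_map L L (\<lambda>x. h \<otimes> x)"
proof -
  have "continuous_map (topo L) (prod_topology (topo L) (topo L)) (\<lambda>x. (h, x))"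
    using h by (intro continuous_map_pairedI) (auto simp: topspace_eq)
  from continuous_map_compose[OF this continuous_mult]
  have cont: "continuous_map (topo L) (topo L) (\<lambda>x. h \<otimes> x)" by (simp add: o_def)
  obtain U1 c1 where c1: "(U1, c1) \<in> charts L" "h \<in> U1" using h by (rule chart_at)
  have "Cinf_on (model L) (c2 ` {x \<in> U2. h \<otimes> x \<in> U3}) (c3 \<circ> (\<lambda>x. h \<otimes> x) \<circ> inv_into U2 c2)"
    if c2: "(U2, c2) \<in> charts L" and c3: "(U3, c3) \<in> charts L" for U2 c2 U3 c3
  proof -
    let ?V = "{x \<in> topspace (topo L). h \<otimes> x \<in> U3}"
    have V: "openin (topo L) ?V"
      using cont chart[OF c3] by (simp add: openin_continuous_map_preimage)
    have eq: "U2 \<inter> ?V = {x \<in> U2. h \<otimes> x \<in> U3}" using chart_subset[OF c2] topspace_eq by auto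
    have Yo: "openin (top_of_set (model L)) (c2 ` {x \<in> U2. h \<otimes> x \<in> U3})" (is "openin _ ?Y")
      using chart_openin[OF c2 V] eq by simp
    let ?Z = "{(s, t). s \<in> c1 ` U1 \<and> t \<in> c2 ` U2 \<and> inv_into U1 c1 s \<otimes> inv_into U2 c2 t \<in> U3}"
    have bl: "bounded_linear (\<lambda>t::'a. (0::'a, t))"
      by (intro bounded_linear_Pair bounded_linear_zero bounded_linear_ident)
    \<comment> \<open>The derivative of the identity along \<open>v\<close> is the constant
      \<open>v\<close>, so every positive order reduces at once to constants.\<close>
    have id: "Cinf_on (model L) ?Y (\<lambda>t. t)"
    proof -
      have "Ck_on k (model L) ?Y (\<lambda>t. t)" for k
      proof (cases k)
        case (Suc m)
        show ?thesis unfolding Suc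
          by (rule Ck_on_SucI[OF subspace_model Yo, where f' = "\<lambda>x v. v"])
            (auto simp: Ck_on_const[OF subspace_model Yo])
      qed (simp add: continuous_on_id)
      then show ?thesis by (simp add: Cinf_on_def)
    qed
    have "Cinf_on (model L) ?Y (\<lambda>t. (c1 h, 0) + (0, t))"
      by (rule Cinf_on_add[OF subspace_model Yo Cinf_on_const[OF subspace_model Yo]
            Cinf_on_linear[OF subspace_model Yo bl id]])
    then have aff: "Cinf_on (model L) ?Y (\<lambda>t. (c1 h, t))" by simp
    have Z: "?Z \<subseteq> model L \<times> model L"
      using openin_imp_subset[OF chart_image_open[OF c1(1)]]
        openin_imp_subset[OF chart_image_open[OF c2]] by auto
    have im: "(\<lambda>t. (c1 h, t)) ` ?Y \<subseteq> ?Z"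
      using c1 c2 by (auto simp: chart_inv)
    have "Cinf_on (model L) ?Y
        (\<lambda>t. (\<lambda>(s, t). c3 (inv_into U1 c1 s \<otimes> inv_into U2 c2 t)) (c1 h, t))"
      by (rule Cinf_on_compose[OF subspace_model Yo subspace_Times[OF subspace_model subspace_model]
            Z im aff smooth_mult[OF c1(1) c2 c3]])
    then show ?thesis
      by (simp add: o_def chart_inv[OF c1])
  qed
  then show ?thesis using cont by (auto simp: smooth_map_def)
qed

lemma smooth_fun_left_translate:
  assumes h: "h \<in> carrier L" and f: "smooth_fun L (carrier L) f"
  shows "smooth_fun L (carrier L) (left_translate L h f)"
  by (rule smooth_fun_cong[OF smooth_fun_compose[OF lie_group_axioms
          smooth_map_left_mult[OF inv_closed[OF h]] f]])
    (simp add: left_translate_def)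

end

section \<open>Continuity in the smooth topology\<close>

text \<open>A common ambient space, closed under sums and products with smooth functions. Continuity
  of operators is established here and then transferred to the induced spaces.\<close>

definition smooth_functions ::
  "('g, 'a::euclidean_space) lie_struct \<Rightarrow> ('g \<Rightarrow> 'b::real_normed_vector) set" where
  "smooth_functions L = {f. smooth_fun L (carrier L) f}"

definition chart_deriv ::
  "'g set \<times> ('g \<Rightarrow> 'a) \<Rightarrow> 'a list \<Rightarrow> ('g \<Rightarrow> 'b) \<Rightarrow> 'a::real_normed_vector \<Rightarrow> 'b::real_normed_vector" where
  "chart_deriv c vs f = foldr dir_deriv vs (f \<circ> inv_into (fst c) (snd c))"

text \<open>The pairs \<open>(c, C)\<close> that, together with a list of directions, index the
  seminorms of the smooth topology.\<close>

definition deriv_domain ::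
  "('g, 'a::euclidean_space) lie_struct \<Rightarrow> 'g set \<times> ('g \<Rightarrow> 'a) \<Rightarrow> 'a set \<Rightarrow> bool" where
  "deriv_domain L c C \<longleftrightarrow> c \<in> charts L \<and> compact C \<and> C \<subseteq> snd c ` fst c"

lemma Cinf_ball_alt:
  "f' \<in> Cinf_ball L F c C vs f e \<longleftrightarrow>
    f' \<in> F \<and> (\<forall>x\<in>C. norm (chart_deriv c vs (\<lambda>g. f' g - f g) x) < e)"
  by (simp add: Cinf_ball_def chart_deriv_def)

lemma foldr_dir_deriv_zero: "foldr dir_deriv vs (\<lambda>_. 0) = (\<lambda>_. 0)"
  by (induction vs) (auto simp: dir_deriv_def)

lemma chart_deriv_zero [simp]: "chart_deriv c vs (\<lambda>_. 0) x = 0"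
  by (simp add: chart_deriv_def o_def foldr_dir_deriv_zero)

lemma openin_Cinf_ball:
  assumes "deriv_domain L c C" "set vs \<subseteq> model L" "f \<in> F" "e > 0"
  shows "openin (Cinf_topology L F) (Cinf_ball L F c C vs f e)"
  unfolding Cinf_topology_def
  by (rule topology_generated_by_Basis) (use assms in \<open>unfold deriv_domain_def, blast\<close>)

lemma centre_in_Cinf_ball: "f \<in> F \<Longrightarrow> e > 0 \<Longrightarrow> f \<in> Cinf_ball L F c C vs f e"
  by (simp add: Cinf_ball_alt)

context lie_group
begin

lemma smooth_functions_diff:
  assumes "f \<in> smooth_functions L" "g \<in> smooth_functions L"
  shows "(\<lambda>x. f x - g x) \<in> smooth_functions L"
  using smooth_fun_add[of f "\<lambda>x. - g x"] assms
    smooth_fun_linear[OF bounded_linear_minus[OF bounded_linear_ident], of g]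
  by (simp add: smooth_functions_def)

lemma smooth_functionsD:
  assumes "f \<in> smooth_functions L" "c \<in> charts L"
  shows "Cinf_on (model L) (snd c ` fst c) (f \<circ> inv_into (fst c) (snd c))"
  using smooth_funD[of f "fst c" "snd c"] assms by (simp add: smooth_functions_def)

lemma chart_image_open': "c \<in> charts L \<Longrightarrow> openin (top_of_set (model L)) (snd c ` fst c)"
  using chart_image_open[of "fst c" "snd c"] by simp

lemma chart_deriv_add:
  assumes "f \<in> smooth_functions L" "g \<in> smooth_functions L" "c \<in> charts L"
    "set vs \<subseteq> model L" "x \<in> snd c ` fst c"
  shows "chart_deriv c vs (\<lambda>x. f x + g x) x = chart_deriv c vs f x + chart_deriv c vs g x"
  using foldr_dir_deriv_add[OF subspace_model chart_image_open'[OF assms(3)]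
      smooth_functionsD[OF assms(1,3)] smooth_functionsD[OF assms(2,3)] assms(4,5)]
  by (simp add: chart_deriv_def o_def)

lemma topspace_Cinf: "topspace (Cinf_topology L F) = F"
proof -
  obtain U c where "(U, c) \<in> charts L" by (rule chart_at[OF one_closed])
  \<comment> \<open>With the empty compact set the ball condition is vacuous, so every member of
    \<open>F\<close> lies in some generator.\<close>
  then have d: "deriv_domain L (U, c) {}" by (simp add: deriv_domain_def)
  have "f \<in> topspace (Cinf_topology L F)" if "f \<in> F" for f
    using openin_subset[OF openin_Cinf_ball[OF d _ that, of "[]" 1]]
      centre_in_Cinf_ball[OF that, of 1 L "(U, c)" "{}" "[]"] by auto
  moreover have "topspace (Cinf_topology L F) \<subseteq> F"
    unfolding Cinf_topology_def topology_generated_by_topspace by (auto simp: Cinf_ball_def)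
  ultimately show ?thesis by blast
qed

text \<open>The derivative of \<open>f0 - f\<close> is continuous on the compact set and attains its
  maximal norm, which is still below \<open>e\<close>; the gap is the new radius. For empty
  \<open>C\<close> there is no maximum, but then all balls are \<open>F\<close>.\<close>

lemma Cinf_ball_recentre:
  assumes F: "F \<subseteq> smooth_functions L" and d: "deriv_domain L c C" and vs: "set vs \<subseteq> model L"
    and f: "f \<in> F" and f0: "f0 \<in> Cinf_ball L F c C vs f e"
  shows "\<exists>\<delta>>0. Cinf_ball L F c C vs f0 \<delta> \<subseteq> Cinf_ball L F c C vs f e"
proof (cases "C = {}")
  case True
  then show ?thesis by (intro exI[of _ 1]) (auto simp: Cinf_ball_def)
next
  case False
  have c: "c \<in> charts L" "compact C" "C \<subseteq> snd c ` fst c" using d by (auto simp: deriv_domain_def)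
  have f0F: "f0 \<in> F" "\<And>x. x \<in> C \<Longrightarrow> norm (chart_deriv c vs (\<lambda>g. f0 g - f g) x) < e"
    using f0 by (auto simp: Cinf_ball_alt)
  have sm: "(\<lambda>g. f0 g - f g) \<in> smooth_functions L"
    using smooth_functions_diff f0F(1) f F by blast
  note X = subspace_model chart_image_open'[OF c(1)]
  have "continuous_on C (chart_deriv c vs (\<lambda>g. f0 g - f g))"
    unfolding chart_deriv_def
    by (rule continuous_on_subset[OF Cinf_on_continuous[OF X Cinf_on_foldr[OF X
            smooth_functionsD[OF sm c(1)] vs]] c(3)])
  then have "continuous_on C (\<lambda>x. norm (chart_deriv c vs (\<lambda>g. f0 g - f g) x))"
    by (rule continuous_on_norm)
  from continuous_attains_sup[OF c(2) False this] obtain x0 where x0: "x0 \<in> C"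
    "\<And>x. x \<in> C \<Longrightarrow> norm (chart_deriv c vs (\<lambda>g. f0 g - f g) x)
      \<le> norm (chart_deriv c vs (\<lambda>g. f0 g - f g) x0)" by blast
  define \<delta> where "\<delta> = e - norm (chart_deriv c vs (\<lambda>g. f0 g - f g) x0)"
  have "\<delta> > 0" using f0F(2)[OF x0(1)] by (simp add: \<delta>_def)
  moreover have "f' \<in> Cinf_ball L F c C vs f e" if f': "f' \<in> Cinf_ball L F c C vs f0 \<delta>" for f'
    unfolding Cinf_ball_alt
  proof (intro conjI ballI)
    show f'F: "f' \<in> F" using f' by (simp add: Cinf_ball_alt)
    fix x assume x: "x \<in> C"
    have sm': "(\<lambda>g. f' g - f0 g) \<in> smooth_functions L"
      using smooth_functions_diff f0F(1) f'F F by blast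
    have "chart_deriv c vs (\<lambda>g. f' g - f g) x
        = chart_deriv c vs (\<lambda>g. (f' g - f0 g) + (f0 g - f g)) x" by simp
    also have "\<dots> = chart_deriv c vs (\<lambda>g. f' g - f0 g) x + chart_deriv c vs (\<lambda>g. f0 g - f g) x"
      by (rule chart_deriv_add[OF sm' sm c(1) vs]) (use x c(3) in blast)
    also have "norm \<dots> \<le> norm (chart_deriv c vs (\<lambda>g. f' g - f0 g) x)
        + norm (chart_deriv c vs (\<lambda>g. f0 g - f g) x)" by (rule norm_triangle_ineq)
    also have "\<dots> < \<delta> + norm (chart_deriv c vs (\<lambda>g. f0 g - f g) x0)"
      using f' x x0(2)[OF x] by (intro add_less_le_mono) (auto simp: Cinf_ball_alt)
    finally show "norm (chart_deriv c vs (\<lambda>g. f' g - f g) x) < e" by (simp add: \<delta>_def)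
  qed
  ultimately show ?thesis by blast
qed

text \<open>The generators have arbitrary centres and form only a subbase. Recentring at
  \<open>M x\<close> reduces continuity to testing one seminorm of \<open>M y - M x\<close> at a
  time.\<close>

lemma continuous_map_Cinf_iff:
  assumes F: "F \<subseteq> smooth_functions L"
  shows "continuous_map X (Cinf_topology L F) M \<longleftrightarrow> M \<in> topspace X \<rightarrow> F \<and>
    (\<forall>x\<in>topspace X. \<forall>c C vs \<delta>. deriv_domain L c C \<longrightarrow> set vs \<subseteq> model L \<longrightarrow> \<delta> > 0 \<longrightarrow>
      (\<exists>U. openin X U \<and> x \<in> U \<and> (\<forall>y\<in>U. \<forall>z\<in>C. norm (chart_deriv c vs (\<lambda>g. M y g - M x g) z) < \<delta>)))"
    (is "?l \<longleftrightarrow> ?m \<and> ?r")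
proof (intro iffI conjI)
  assume l: ?l
  then show m: ?m using continuous_map_funspace topspace_Cinf by blast
  show ?r
  proof (intro ballI allI impI)
    fix x c C vs and \<delta> :: real
    assume x: "x \<in> topspace X" and d: "deriv_domain L c C" "set vs \<subseteq> model L" "\<delta> > 0"
    have Mx: "M x \<in> F" using m x by auto
    let ?U = "{y \<in> topspace X. M y \<in> Cinf_ball L F c C vs (M x) \<delta>}"
    have "openin X ?U"
      by (rule openin_continuous_map_preimage[OF l openin_Cinf_ball[OF d(1,2) Mx d(3)]])
    moreover have "x \<in> ?U" using x centre_in_Cinf_ball[OF Mx d(3)] by simp
    moreover have "\<forall>y\<in>?U. \<forall>z\<in>C. norm (chart_deriv c vs (\<lambda>g. M y g - M x g) z) < \<delta>"
      by (simp add: Cinf_ball_alt)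
    ultimately show "\<exists>U. openin X U \<and> x \<in> U \<and>
        (\<forall>y\<in>U. \<forall>z\<in>C. norm (chart_deriv c vs (\<lambda>g. M y g - M x g) z) < \<delta>)" by blast
  qed
next
  assume mr: "?m \<and> ?r"
  show ?l
    unfolding Cinf_topology_def continuous_on_generated_topo_iff
  proof (intro conjI allI impI)
    let ?S = "{Cinf_ball L F c C vs f e |c C vs f e.
        c \<in> charts L \<and> compact C \<and> C \<subseteq> snd c ` fst c \<and> set vs \<subseteq> model L \<and> f \<in> F \<and> e > 0}"
    have "\<Union>?S = F"
      using topspace_Cinf[of F] unfolding Cinf_topology_def topology_generated_by_topspace .
    then show "M ` topspace X \<subseteq> \<Union>?S" using mr by auto
    fix V assume "V \<in> ?S"
    then obtain c C vs f e where V: "V = Cinf_ball L F c C vs f e" "deriv_domain L c C"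
      "set vs \<subseteq> model L" "f \<in> F" "e > 0" unfolding deriv_domain_def by blast
    show "openin X (M -` V \<inter> topspace X)"
    proof (subst openin_subopen, intro ballI)
      fix x assume "x \<in> M -` V \<inter> topspace X"
      then have x: "x \<in> topspace X" "M x \<in> Cinf_ball L F c C vs f e" using V(1) by auto
      then obtain \<delta> where \<delta>: "\<delta> > 0" "Cinf_ball L F c C vs (M x) \<delta> \<subseteq> V"
        using Cinf_ball_recentre[OF F V(2-4)] V(1) by blast
      obtain U where U: "openin X U" "x \<in> U"
        "\<forall>y\<in>U. \<forall>z\<in>C. norm (chart_deriv c vs (\<lambda>g. M y g - M x g) z) < \<delta>"
        using mr x(1) V(2,3) \<delta>(1) by meson
      have "M y \<in> V" if "y \<in> U" for y
      proof -
        have "M y \<in> F" using mr openin_subset[OF U(1)] that by blast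
        then have "M y \<in> Cinf_ball L F c C vs (M x) \<delta>" using U(3) that by (simp add: Cinf_ball_alt)
        then show ?thesis using \<delta>(2) by blast
      qed
      then show "\<exists>U. openin X U \<and> x \<in> U \<and> U \<subseteq> M -` V \<inter> topspace X"
        using U(1,2) openin_subset[OF U(1)] by blast
    qed
  qed
qed

text \<open>The seminorm criterion mentions \<open>F\<close> only through the range of
  \<open>M\<close>, so \<open>F\<close> behaves as a topological subspace of all smooth
  functions.\<close>

lemma continuous_map_Cinf_smooth_functions:
  assumes F: "F \<subseteq> smooth_functions L"
  shows "continuous_map X (Cinf_topology L F) M \<longleftrightarrow>
    M \<in> topspace X \<rightarrow> F \<and> continuous_map X (Cinf_topology L (smooth_functions L)) M"
  unfolding continuous_map_Cinf_iff[OF F] continuous_map_Cinf_iff[OF order_refl]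
  using F by blast

lemma continuous_map_Cinf_add:
  assumes "continuous_map X (Cinf_topology L (smooth_functions L)) M"
    and "continuous_map X (Cinf_topology L (smooth_functions L)) M'"
  shows "continuous_map X (Cinf_topology L (smooth_functions L)) (\<lambda>x g. M x g + M' x g)"
proof -
  note iff = continuous_map_Cinf_iff[OF order_refl, THEN iffD1, THEN conjunct2, rule_format]
  have M: "M x \<in> smooth_functions L" "M' x \<in> smooth_functions L" if "x \<in> topspace X" for x
    using assms that continuous_map_funspace topspace_Cinf by blast+
  show ?thesis
    unfolding continuous_map_Cinf_iff[OF order_refl]
  proof (intro conjI ballI allI impI)
    show "(\<lambda>x g. M x g + M' x g) \<in> topspace X \<rightarrow> smooth_functions L"
      using M by (auto simp: smooth_functions_def intro: smooth_fun_add)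
    fix x c C vs and \<delta> :: real
    assume x: "x \<in> topspace X" and d: "deriv_domain L c C" "set vs \<subseteq> model L" "\<delta> > 0"
    have c: "c \<in> charts L" "C \<subseteq> snd c ` fst c" using d by (auto simp: deriv_domain_def)
    have \<delta>: "\<delta>/2 > 0" using d by simp
    obtain U where U: "openin X U" "x \<in> U"
      "\<forall>y\<in>U. \<forall>z\<in>C. norm (chart_deriv c vs (\<lambda>g. M y g - M x g) z) < \<delta>/2"
      using iff[OF assms(1) x d(1,2) \<delta>] by blast
    obtain U' where U': "openin X U'" "x \<in> U'"
      "\<forall>y\<in>U'. \<forall>z\<in>C. norm (chart_deriv c vs (\<lambda>g. M' y g - M' x g) z) < \<delta>/2"
      using iff[OF assms(2) x d(1,2) \<delta>] by blast
    have "norm (chart_deriv c vs (\<lambda>g. M y g + M' y g - (M x g + M' x g)) z) < \<delta>"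
      if y: "y \<in> U \<inter> U'" and z: "z \<in> C" for y z
    proof -
      have yX: "y \<in> topspace X" using openin_subset[OF U(1)] y by blast
      have "chart_deriv c vs (\<lambda>g. M y g + M' y g - (M x g + M' x g)) z
        = chart_deriv c vs (\<lambda>g. (M y g - M x g) + (M' y g - M' x g)) z"
        by (simp add: algebra_simps)
      also have "\<dots> = chart_deriv c vs (\<lambda>g. M y g - M x g) z + chart_deriv c vs (\<lambda>g. M' y g - M' x g) z"
        by (rule chart_deriv_add[OF smooth_functions_diff smooth_functions_diff])
          (use M yX x c z d in auto)
      also have "norm \<dots> < \<delta>/2 + \<delta>/2"
        by (rule norm_add_less) (use U(3) U'(3) y z in auto)
      finally show ?thesis by simp
    qed
    then show "\<exists>U. openin X U \<and> x \<in> U \<and> (\<forall>y\<in>U. \<forall>z\<in>C.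
        norm (chart_deriv c vs (\<lambda>g. M y g + M' y g - (M x g + M' x g)) z) < \<delta>)"
      using U(1,2) U'(1,2) by (intro exI[of _ "U \<inter> U'"]) auto
  qed
qed

lemma continuous_map_Cinf_sum:
  assumes "\<And>i. i \<in> I \<Longrightarrow> continuous_map X (Cinf_topology L (smooth_functions L)) (M i)"
  shows "continuous_map X (Cinf_topology L (smooth_functions L)) (\<lambda>x g. \<Sum>i\<in>I. M i x g)"
  using assms
proof (induction I rule: infinite_finite_induct)
  case (insert i I)
  then show ?case by (simp add: continuous_map_Cinf_add)
qed (simp_all add: topspace_Cinf smooth_functions_def smooth_fun_const)

text \<open>The difference of two products is the product with the difference, so
  \<open>foldr_bilinear_bound\<close> estimates its derivative by finitely many seminorms of
  \<open>M y - M x\<close>.\<close>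

lemma continuous_map_Cinf_bilinear:
  assumes B: "bounded_bilinear B" and \<phi>: "\<phi> \<in> smooth_functions L"
    and M: "continuous_map X (Cinf_topology L (smooth_functions L)) M"
  shows "continuous_map X (Cinf_topology L (smooth_functions L)) (\<lambda>x g. B (\<phi> g) (M x g))"
proof -
  note iff = continuous_map_Cinf_iff[OF order_refl, THEN iffD1, THEN conjunct2, rule_format]
  have Ms: "M x \<in> smooth_functions L" if "x \<in> topspace X" for x
    using M that continuous_map_funspace topspace_Cinf by blast
  show ?thesis
    unfolding continuous_map_Cinf_iff[OF order_refl]
  proof (intro conjI ballI allI impI)
    show "(\<lambda>x g. B (\<phi> g) (M x g)) \<in> topspace X \<rightarrow> smooth_functions L"
      using Ms \<phi> by (auto simp: smooth_functions_def intro: smooth_fun_bilinear[OF B])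
    fix x c C vs and \<delta> :: real
    assume x: "x \<in> topspace X" and d: "deriv_domain L c C" "set vs \<subseteq> model L" "\<delta> > 0"
    have c: "c \<in> charts L" "compact C" "C \<subseteq> snd c ` fst c" using d by (auto simp: deriv_domain_def)
    obtain W K where W: "finite W" "K \<ge> 0" "\<forall>ws\<in>W. set ws \<subseteq> model L"
      and bound: "\<forall>g. Cinf_on (model L) (snd c ` fst c) g \<longrightarrow> (\<forall>z\<in>C.
        norm (foldr dir_deriv vs (\<lambda>x. B ((\<phi> \<circ> inv_into (fst c) (snd c)) x) (g x)) z)
          \<le> K * (\<Sum>ws\<in>W. norm (foldr dir_deriv ws g z)))"
      using foldr_bilinear_bound[OF subspace_model chart_image_open'[OF c(1)] B c(2,3) d(2)
          smooth_functionsD[OF \<phi> c(1)]] by (elim exE conjE) (rule that)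
    \<comment> \<open>Each of the \<open>card W\<close> terms may contribute \<epsilon>. The summand
      1 keeps the denominator positive when \<open>K * card W\<close> vanishes and makes the final
      estimate strict.\<close>
    define \<epsilon> where "\<epsilon> = \<delta> / (K * card W + 1)"
    have pos: "K * card W + 1 > 0" using W(2) by (simp add: add_nonneg_pos)
    have \<epsilon>: "\<epsilon> > 0" using d(3) pos by (simp add: \<epsilon>_def)
    \<comment> \<open>One neighbourhood for all words at once, as a finite intersection built by
      induction on \<open>W\<close>.\<close>
    have "\<exists>U. openin X U \<and> x \<in> U \<and> (\<forall>ws\<in>W. \<forall>y\<in>U. \<forall>z\<in>C.
        norm (chart_deriv c ws (\<lambda>g. M y g - M x g) z) < \<epsilon>)"
      using W(1,3)
    proof (induction W rule: finite_induct)
      case empty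
      then show ?case using x by blast
    next
      case (insert ws W)
      then obtain U where U: "openin X U" "x \<in> U" "\<forall>ws\<in>W. \<forall>y\<in>U. \<forall>z\<in>C.
        norm (chart_deriv c ws (\<lambda>g. M y g - M x g) z) < \<epsilon>" by auto
      obtain U' where U': "openin X U'" "x \<in> U'"
        "\<forall>y\<in>U'. \<forall>z\<in>C. norm (chart_deriv c ws (\<lambda>g. M y g - M x g) z) < \<epsilon>"
        using iff[OF M x d(1) _ \<epsilon>, of ws] insert.prems by auto
      show ?case
        using U U' by (intro exI[of _ "U \<inter> U'"]) auto
    qed
    then obtain U where U: "openin X U" "x \<in> U" "\<And>ws y z. ws \<in> W \<Longrightarrow> y \<in> U \<Longrightarrow> z \<in> C \<Longrightarrow>
        norm (chart_deriv c ws (\<lambda>g. M y g - M x g) z) < \<epsilon>" by blast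
    have "norm (chart_deriv c vs (\<lambda>g. B (\<phi> g) (M y g) - B (\<phi> g) (M x g)) z) < \<delta>"
      if y: "y \<in> U" and z: "z \<in> C" for y z
    proof -
      have yX: "y \<in> topspace X" using openin_subset[OF U(1)] y by blast
      have sm: "(\<lambda>g. M y g - M x g) \<in> smooth_functions L"
        by (rule smooth_functions_diff[OF Ms[OF yX] Ms[OF x]])
      have "norm (chart_deriv c vs (\<lambda>g. B (\<phi> g) (M y g) - B (\<phi> g) (M x g)) z)
          \<le> K * (\<Sum>ws\<in>W. norm (chart_deriv c ws (\<lambda>g. M y g - M x g) z))"
        using bound[rule_format, OF smooth_functionsD[OF sm c(1)] z]
        by (simp add: chart_deriv_def o_def bounded_bilinear.diff_right[OF B])
      also have "\<dots> \<le> K * (card W * \<epsilon>)"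
        by (intro mult_left_mono W(2) sum_bounded_above less_imp_le U(3) y z)
      also have "\<dots> = (K * card W) * \<epsilon>" by simp
      also have "\<dots> < (K * card W + 1) * \<epsilon>" using \<epsilon> by simp
      also have "\<dots> = \<delta>" using pos by (simp add: \<epsilon>_def)
      finally show ?thesis .
    qed
    then show "\<exists>U. openin X U \<and> x \<in> U \<and> (\<forall>y\<in>U. \<forall>z\<in>C.
        norm (chart_deriv c vs (\<lambda>g. B (\<phi> g) (M y g) - B (\<phi> g) (M x g)) z) < \<delta>)"
      using U(1,2) by blast
  qed
qed

text \<open>Evaluation at \<open>a\<close> is controlled by the seminorm of order zero over the
  one-point compact set \<open>{c a}\<close>. This makes the value of an intertwiner at the unit a
  distribution.\<close>

lemma continuous_map_Cinf_eval:
  assumes F: "F \<subseteq> smooth_functions L" and a: "a \<in> carrier L"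
  shows "continuous_map (Cinf_topology L F) euclidean (\<lambda>f. f a)"
  unfolding continuous_map_def
proof (intro conjI allI impI)
  fix V :: "'b set" assume "openin euclidean V"
  then have V: "open V" by simp
  obtain U c where c: "(U, c) \<in> charts L" "a \<in> U" using a by (rule chart_at)
  have d: "deriv_domain L (U, c) {c a}" using c by (simp add: deriv_domain_def)
  show "openin (Cinf_topology L F) {f \<in> topspace (Cinf_topology L F). f a \<in> V}"
  proof (subst openin_subopen, intro ballI)
    fix f assume "f \<in> {f \<in> topspace (Cinf_topology L F). f a \<in> V}"
    then have f: "f \<in> F" "f a \<in> V" by (auto simp: topspace_Cinf)
    obtain e where e: "e > 0" "ball (f a) e \<subseteq> V" using V f(2) by (meson openE)
    let ?B = "Cinf_ball L F (U, c) {c a} [] f e"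
    have "f' a \<in> V" if "f' \<in> ?B" for f'
    proof -
      have "norm (f' a - f a) < e" using that by (simp add: Cinf_ball_def chart_inv[OF c])
      then have "f' a \<in> ball (f a) e" by (simp add: dist_norm norm_minus_commute)
      then show ?thesis using e by blast
    qed
    then have "?B \<subseteq> {f \<in> topspace (Cinf_topology L F). f a \<in> V}"
      by (auto simp: topspace_Cinf Cinf_ball_alt)
    then show "\<exists>T. openin (Cinf_topology L F) T \<and> f \<in> T \<and>
        T \<subseteq> {f \<in> topspace (Cinf_topology L F). f a \<in> V}"
      using openin_Cinf_ball[OF d _ f(1) e(1), of "[]"] centre_in_Cinf_ball[OF f(1) e(1)]
      by (intro exI[of _ ?B]) simp
  qed
qed simp

end

section \<open>Induced sections and contraction\<close>

lemma bounded_linear_scale_vec: "bounded_linear (\<lambda>x::complex^'n. z *s x)"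
  unfolding linear_conv_bounded_linear[symmetric]
  by (rule linearI) (simp_all add: vec_eq_iff algebra_simps)

lemma sum_UNIV_prod:
  "(\<Sum>r\<in>(UNIV :: ('m::finite \<times> 'n::finite) set). f (fst r) (snd r)) = (\<Sum>a\<in>UNIV. \<Sum>b\<in>UNIV. f a b)"
  unfolding UNIV_Times_UNIV[symmetric] sum.cartesian_product by (simp add: case_prod_unfold)

lemma matrix_eq_component: "A $ i $ j = (A *v axis j 1) $ i"
  for A :: "complex^'n^'m"
  by (simp add: matrix_vector_mult_def axis_def if_distrib cong: if_cong)

lemma a_power_mult: "a_power L A \<mu> a * a_power L A \<nu> a = a_power L A (\<lambda>X. \<mu> X + \<nu> X) a"
  by (simp add: a_power_def exp_add)

lemma a_power_uminus: "a_power L A (\<lambda>X. - \<mu> X) a * a_power L A \<mu> a = 1"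
  by (simp add: a_power_def flip: exp_add)

text \<open>The pointwise form of \<open>contract\<close>, isolated as a bilinear map so that the
  results on products with smooth functions apply.\<close>

definition contract_at :: "'e2 \<Rightarrow> complex^'e1^'e2 \<Rightarrow> complex^('v \<times> 'e1) \<Rightarrow> complex^'v" where
  "contract_at k A x = (\<chi> v. \<Sum>j\<in>UNIV. A $ k $ j * x $ (v, j))"

text \<open>\<open>column_tensor e A y\<close> is \<open>y \<otimes> A e\<^sub>e \<in> W \<otimes> E''\<close>, for the basis vector \<open>e\<^sub>e\<close> of \<open>E\<close>.\<close>

definition column_tensor :: "'e \<Rightarrow> complex^'e^'e2 \<Rightarrow> complex^'w \<Rightarrow> complex^('w \<times> 'e2)" where
  "column_tensor e A y = (\<chi> r. A $ snd r $ e * y $ fst r)"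

lemma contract_eq: "contract \<phi> k \<psi> = (\<lambda>g. contract_at k (\<phi> g) (\<psi> g))"
  by (simp add: fun_eq_iff contract_def contract_at_def)

text \<open>A row of \<open>C ** B\<close> is the combination of the rows of \<open>B\<close> with
  coefficients from \<open>C\<close>. This is how a factor independent of \<open>g\<close> leaves
  the pairing.\<close>

lemma contract_at_matrix_mult:
  "contract_at k (C ** B) x = (\<Sum>e\<in>UNIV. C $ k $ e *s contract_at e B x)"
  by (simp add: contract_at_def matrix_matrix_mult_def vec_eq_iff sum_distrib_left
      sum_distrib_right mult_ac) (intro allI sum.swap)

lemma bounded_bilinear_contract_at: "bounded_bilinear (contract_at k)"
  unfolding bilinear_conv_bounded_bilinear[symmetric] bilinear_def
  by (intro conjI allI linearI)
    (simp_all add: contract_at_def vec_eq_iff algebra_simps sum.distrib scaleR_sum_right)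

lemma bounded_bilinear_column_tensor: "bounded_bilinear (column_tensor e)"
  unfolding bilinear_conv_bounded_bilinear[symmetric] bilinear_def
  by (intro conjI allI linearI) (simp_all add: column_tensor_def vec_eq_iff algebra_simps)

lemma bounded_bilinear_scale_vec: "bounded_bilinear (\<lambda>(z::complex) (x::complex^'n). z *s x)"
  unfolding bilinear_conv_bounded_bilinear[symmetric] bilinear_def
  by (intro conjI allI linearI) (simp_all add: vec_eq_iff algebra_simps)

context lie_group
begin

lemma fin_rep_inv:
  assumes "fin_rep L S \<xi>" "subgroup S L" "m \<in> S"
  shows "\<xi> m ** \<xi> (inv m) = mat 1" "\<xi> (inv m) ** \<xi> m = mat 1"
proof -
  have m: "inv m \<in> S" "m \<in> carrier L"
    using assms subgroup.m_inv_closed subgroup.mem_carrier by metis+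
  then show "\<xi> m ** \<xi> (inv m) = mat 1" "\<xi> (inv m) ** \<xi> m = mat 1"
    using assms(1,3) unfolding fin_rep_def by (metis r_inv, metis l_inv)
qed

lemma Ind_smooth: "Ind L M A N \<xi> lam \<subseteq> smooth_functions L"
  by (auto simp: Ind_def smooth_functions_def)

lemma Ind_outside: "f \<in> Ind L M A N \<xi> lam \<Longrightarrow> x \<notin> carrier L \<Longrightarrow> f x = 0"
  by (simp add: Ind_def)

lemma Ind_equivariant:
  "f \<in> Ind L M A N \<xi> lam \<Longrightarrow> g \<in> carrier L \<Longrightarrow> m \<in> M \<Longrightarrow> a \<in> A \<Longrightarrow> n \<in> N \<Longrightarrow>
    f (g \<otimes> (m \<otimes> a \<otimes> n)) =
      a_power L A (\<lambda>X. - lam X - of_real (rho L N X)) a *s (\<xi> (inv m) *v f g)"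
  by (simp add: Ind_def)

lemma IndI:
  assumes "\<And>x. x \<notin> carrier L \<Longrightarrow> f x = 0" "smooth_fun L (carrier L) f"
    "\<And>g m a n. g \<in> carrier L \<Longrightarrow> m \<in> M \<Longrightarrow> a \<in> A \<Longrightarrow> n \<in> N \<Longrightarrow>
      f (g \<otimes> (m \<otimes> a \<otimes> n)) =
        a_power L A (\<lambda>X. - lam X - of_real (rho L N X)) a *s (\<xi> (inv m) *v f g)"
  shows "f \<in> Ind L M A N \<xi> lam"
  using assms by (simp add: Ind_def)

lemma Ind_zero: "(\<lambda>_. 0) \<in> Ind L M A N \<xi> lam"
  by (rule IndI) (simp_all add: smooth_fun_const)

lemma Ind_add:
  assumes "f \<in> Ind L M A N \<xi> lam" "f' \<in> Ind L M A N \<xi> lam"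
  shows "(\<lambda>x. f x + f' x) \<in> Ind L M A N \<xi> lam"
proof (rule IndI)
  show "smooth_fun L (carrier L) (\<lambda>x. f x + f' x)"
    using assms by (intro smooth_fun_add) (simp_all add: Ind_def)
qed (simp_all add: Ind_outside[OF assms(1)] Ind_outside[OF assms(2)] Ind_equivariant[OF assms(1)]
    Ind_equivariant[OF assms(2)] matrix_vector_right_distrib vector_add_ldistrib)

lemma Ind_scale:
  assumes "f \<in> Ind L M A N \<xi> lam"
  shows "(\<lambda>x. z *s f x) \<in> Ind L M A N \<xi> lam"
proof (rule IndI)
  show "smooth_fun L (carrier L) (\<lambda>x. z *s f x)"
    using assms by (intro smooth_fun_linear[OF bounded_linear_scale_vec]) (simp add: Ind_def)
qed (simp_all add: Ind_outside[OF assms] Ind_equivariant[OF assms] vector_scalar_commute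
    vector_smult_assoc mult.commute)

lemma Ind_sum:
  "(\<And>i. i \<in> I \<Longrightarrow> f i \<in> Ind L M A N \<xi> lam) \<Longrightarrow> (\<lambda>x. \<Sum>i\<in>I. z i *s f i x) \<in> Ind L M A N \<xi> lam"
  by (induction I rule: infinite_finite_induct) (simp_all add: Ind_zero Ind_add Ind_scale)

lemma Ind_left_translate:
  assumes f: "f \<in> Ind L M A N \<xi> lam" and h: "h \<in> carrier L"
    and sub: "subgroup M L" "subgroup A L" "subgroup N L"
  shows "left_translate L h f \<in> Ind L M A N \<xi> lam"
proof (rule IndI)
  show "smooth_fun L (carrier L) (left_translate L h f)"
    using f by (intro smooth_fun_left_translate[OF h]) (simp add: Ind_def)
  fix g m a n assume g: "g \<in> carrier L" and man: "m \<in> M" "a \<in> A" "n \<in> N"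
  then have p: "m \<otimes> a \<otimes> n \<in> carrier L" using sub by (simp add: subgroup.mem_carrier)
  then have "left_translate L h f (g \<otimes> (m \<otimes> a \<otimes> n)) = f ((inv h \<otimes> g) \<otimes> (m \<otimes> a \<otimes> n))"
    using g h by (simp add: left_translate_def m_assoc)
  then show "left_translate L h f (g \<otimes> (m \<otimes> a \<otimes> n)) =
      a_power L A (\<lambda>X. - lam X - of_real (rho L N X)) a *s (\<xi> (inv m) *v left_translate L h f g)"
    using g h by (simp add: Ind_equivariant[OF f _ man] left_translate_def)
qed (simp add: left_translate_def)

text \<open>Under right translation by \<open>m a n\<close>, \<phi> gains \<tau>'(m) and the
  \<mu>'-power of \<open>a\<close>, while \<psi> carries the inverses of both. They cancel and leave
  the law for \<xi> at \<lambda>.\<close>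

lemma contract_Ind:
  fixes \<tau>' :: "_ \<Rightarrow> complex^'e1^'e1"
  assumes \<phi>: "\<phi> \<in> hom_sections L M A N \<tau>' \<mu>'" and \<tau>': "fin_rep L M \<tau>'" and M: "subgroup M L"
    and \<psi>: "\<psi> \<in> Ind L M A N (tensor_rep \<xi> \<tau>') (\<lambda>X. lam X + \<mu>' X)"
  shows "contract \<phi> k \<psi> \<in> Ind L M A N \<xi> lam"
proof (rule IndI)
  show "contract \<phi> k \<psi> x = 0" if "x \<notin> carrier L" for x
    using that \<phi> by (simp add: contract_def hom_sections_def vec_eq_iff)
  show "smooth_fun L (carrier L) (contract \<phi> k \<psi>)"
    unfolding contract_eq using \<phi> \<psi>
    by (intro smooth_fun_bilinear[OF bounded_bilinear_contract_at]) (simp_all add: hom_sections_def Ind_def)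
  fix g m a n assume g: "g \<in> carrier L" and man: "m \<in> M" "a \<in> A" "n \<in> N"
  let ?q = "g \<otimes> (m \<otimes> a \<otimes> n)"
  define c1 where "c1 = a_power L A \<mu>' a"
  define c2 where "c2 = a_power L A (\<lambda>X. - (lam X + \<mu>' X) - of_real (rho L N X)) a"
  have c: "c1 * c2 = a_power L A (\<lambda>X. - lam X - of_real (rho L N X)) a"
    unfolding c1_def c2_def a_power_mult by (simp add: algebra_simps)
  have "contract \<phi> k \<psi> ?q $ v = c1 * c2 * (\<xi> (inv m) *v contract \<phi> k \<psi> g) $ v" for v
  proof -
    \<comment> \<open>Fixing the component \<open>v\<close> and applying only \<xi> leaves a vector
      of E', on which \<phi> acts as a matrix and \<tau>' can cancel.\<close>
    define w :: "complex^'e1" where "w = (\<chi> j. \<Sum>v'\<in>UNIV. \<xi> (inv m) $ v $ v' * \<psi> g $ (v', j))"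
    have \<psi>q: "\<psi> ?q $ (v, j) = (c2 *s (\<tau>' (inv m) *v w)) $ j" for j
    proof -
      have "\<psi> ?q $ (v, j) = c2 * (\<Sum>s\<in>UNIV. \<xi> (inv m) $ v $ fst s * \<tau>' (inv m) $ j $ snd s * \<psi> g $ (fst s, snd s))"
        using Ind_equivariant[OF \<psi> g man]
        by (simp add: c2_def matrix_vector_mult_def tensor_rep_def)
      also have "\<dots> = c2 * (\<Sum>j'\<in>UNIV. \<Sum>v'\<in>UNIV. \<xi> (inv m) $ v $ v' * \<tau>' (inv m) $ j $ j' * \<psi> g $ (v', j'))"
        by (subst sum_UNIV_prod, subst sum.swap) simp
      finally show ?thesis
        by (simp add: w_def matrix_vector_mult_def sum_distrib_left mult_ac)
    qed
    have "contract \<phi> k \<psi> ?q $ v = (\<phi> ?q *v (c2 *s (\<tau>' (inv m) *v w))) $ k"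
      by (simp add: contract_def \<psi>q matrix_vector_mult_def)
    also have "\<phi> ?q *v (c2 *s (\<tau>' (inv m) *v w)) = \<phi> g *v (c1 *s (\<tau>' m *v (c2 *s (\<tau>' (inv m) *v w))))"
      using \<phi> g man by (simp add: hom_sections_def man_action_def c1_def)
    also have "\<dots> = (c1 * c2) *s (\<phi> g *v ((\<tau>' m ** \<tau>' (inv m)) *v w))"
      by (simp add: vector_scalar_commute vector_smult_assoc matrix_vector_mul_assoc)
    also have "\<dots> = (c1 * c2) *s (\<phi> g *v w)"
      by (simp add: fin_rep_inv[OF \<tau>' M man(1)])
    also have "(\<phi> g *v w) $ k = (\<Sum>v'\<in>UNIV. \<Sum>j\<in>UNIV. \<xi> (inv m) $ v $ v' * (\<phi> g $ k $ j * \<psi> g $ (v', j)))"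
      by (subst sum.swap) (simp add: matrix_vector_mult_def w_def sum_distrib_left mult_ac)
    then have "((c1 * c2) *s (\<phi> g *v w)) $ k = c1 * c2 * (\<xi> (inv m) *v contract \<phi> k \<psi> g) $ v"
      by (simp add: matrix_vector_mult_def contract_def sum_distrib_left)
    finally show ?thesis .
  qed
  then show "contract \<phi> k \<psi> ?q =
      a_power L A (\<lambda>X. - lam X - of_real (rho L N X)) a *s (\<xi> (inv m) *v contract \<phi> k \<psi> g)"
    by (simp add: vec_eq_iff c)
qed

text \<open>Multiplicativity puts \<open>\<tau> (m \<otimes> a \<otimes> n)\<close> directly in
  front of \<open>i\<close>, which converts it into the action on E'.\<close>

lemma transl_section_hom_sections:
  assumes \<tau>: "fin_rep L (carrier L) \<tau>" and sub: "subgroup M L" "subgroup A L" "subgroup N L"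
    and i: "\<And>m a n x. m \<in> M \<Longrightarrow> a \<in> A \<Longrightarrow> n \<in> N \<Longrightarrow>
      \<tau> (m \<otimes> a \<otimes> n) *v (i *v x) = i *v man_action L A \<tau>' \<mu>' m a x"
  shows "transl_section L p \<tau> i \<in> hom_sections L M A N \<tau>' \<mu>'"
  unfolding hom_sections_def mem_Collect_eq
proof (intro conjI allI impI ballI)
  show "transl_section L p \<tau> i x = 0" if "x \<notin> carrier L" for x
    using that by (simp add: transl_section_def)
  have \<tau>s: "smooth_fun L (carrier L) \<tau>"
    using \<tau> by (intro smooth_on_subset_carrier) (simp add: fin_rep_def)
  have "bounded_linear (\<lambda>T. p ** T ** i)"
    unfolding linear_conv_bounded_linear[symmetric]
    by (rule linearI)
      (simp_all add: vec_eq_iff matrix_matrix_mult_def algebra_simps sum.distrib scaleR_sum_right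
        sum_distrib_left)
  from smooth_fun_linear[OF this \<tau>s] show "smooth_fun L (carrier L) (transl_section L p \<tau> i)"
    by (rule smooth_fun_cong) (simp add: transl_section_def)
  fix g m a n x assume g: "g \<in> carrier L" and man: "m \<in> M" "a \<in> A" "n \<in> N"
  then have q: "m \<otimes> a \<otimes> n \<in> carrier L" using sub by (simp add: subgroup.mem_carrier)
  have "\<tau> (g \<otimes> (m \<otimes> a \<otimes> n)) = \<tau> g ** \<tau> (m \<otimes> a \<otimes> n)"
    using \<tau> g q unfolding fin_rep_def by blast
  then show "transl_section L p \<tau> i (g \<otimes> (m \<otimes> a \<otimes> n)) *v x =
      transl_section L p \<tau> i g *v man_action L A \<tau>' \<mu>' m a x"
    using g q by (simp add: transl_section_def i[OF man] flip: matrix_vector_mul_assoc)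
qed

text \<open>Rests on \<open>\<tau> g = \<tau> h ** \<tau> (inv h \<otimes> g)\<close>. For
  \<open>p = mat 1\<close> it says how translation mixes the components in E; for
  \<open>h = \<one>\<close> it expands the pairing with \<phi> in those components.\<close>

lemma contract_transl_section:
  assumes \<tau>: "fin_rep L (carrier L) \<tau>" and h: "h \<in> carrier L"
  shows "contract (transl_section L p \<tau> i) k (left_translate L h \<psi>) =
    (\<lambda>g. \<Sum>e\<in>UNIV. (p ** \<tau> h) $ k $ e *s
      left_translate L h (contract (transl_section L (mat 1) \<tau> i) e \<psi>) g)"
proof
  fix g
  show "contract (transl_section L p \<tau> i) k (left_translate L h \<psi>) g =
    (\<Sum>e\<in>UNIV. (p ** \<tau> h) $ k $ e *s
      left_translate L h (contract (transl_section L (mat 1) \<tau> i) e \<psi>) g)"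
  proof (cases "g \<in> carrier L")
    case False
    then show ?thesis by (simp add: contract_def transl_section_def left_translate_def vec_eq_iff)
  next
    case True
    have "\<tau> g = \<tau> h ** \<tau> (inv h \<otimes> g)"
      using \<tau> h True unfolding fin_rep_def by (metis inv_closed m_assoc m_closed l_one r_inv)
    then have eq: "p ** \<tau> g ** i = (p ** \<tau> h) ** (\<tau> (inv h \<otimes> g) ** i)"
      by (simp add: matrix_mul_assoc)
    show ?thesis
      using True h
      by (simp add: contract_eq transl_section_def left_translate_def eq contract_at_matrix_mult)
  qed
qed

text \<open>Even translation by the unit resets values outside the carrier to 0, hence the
  hypothesis.\<close>

lemma left_translate_one:
  assumes "\<And>x. x \<notin> carrier L \<Longrightarrow> f x = 0"
  shows "left_translate L \<one> f = f"
  using assms by (auto simp: left_translate_def fun_eq_iff)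

end

section \<open>Intertwining operators and their kernels\<close>

locale closed_subgroup_pair = G: lie_group G + H: lie_group H
  for G :: "('g, 'a::euclidean_space) lie_struct" and H :: "('g, 'b::euclidean_space) lie_struct" +
  assumes carrier_subset: "carrier H \<subseteq> carrier G"
    and mult_eq: "x \<in> carrier H \<Longrightarrow> y \<in> carrier H \<Longrightarrow> x \<otimes>\<^bsub>H\<^esub> y = x \<otimes>\<^bsub>G\<^esub> y"
    and smooth_inclusion: "smooth_map H G (\<lambda>x. x)"
begin

lemma one_eq: "\<one>\<^bsub>H\<^esub> = \<one>\<^bsub>G\<^esub>"
  using mult_eq[of "\<one>\<^bsub>H\<^esub>" "\<one>\<^bsub>H\<^esub>"] carrier_subset
  by (metis G.r_cancel_one' H.one_closed H.r_one subsetD)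

lemma inv_eq: "x \<in> carrier H \<Longrightarrow> inv\<^bsub>H\<^esub> x = inv\<^bsub>G\<^esub> x"
  using mult_eq[of "inv\<^bsub>H\<^esub> x" x] carrier_subset one_eq
  by (metis G.inv_equality H.inv_closed H.l_inv subsetD)

lemma intertwinerD:
  assumes "T \<in> intertwiners G H \<F> \<H>"
  shows "f \<notin> \<F> \<Longrightarrow> T f = (\<lambda>_. 0)" "f \<in> \<F> \<Longrightarrow> T f \<in> \<H>"
    "f \<in> \<F> \<Longrightarrow> f' \<in> \<F> \<Longrightarrow> T (\<lambda>x. f x + f' x) = (\<lambda>x. T f x + T f' x)"
    "f \<in> \<F> \<Longrightarrow> T (\<lambda>x. z *s f x) = (\<lambda>x. z *s T f x)"
    "continuous_map (Cinf_topology G \<F>) (Cinf_topology H \<H>) T"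
    "h \<in> carrier H \<Longrightarrow> f \<in> \<F> \<Longrightarrow> T (left_translate G h f) = left_translate H h (T f)"
  using assms unfolding intertwiners_def by simp_all

lemma intertwiner_at_one:
  assumes T: "T \<in> intertwiners G H \<F> \<H>" and f: "f \<in> \<F>" and h: "h \<in> carrier H"
  shows "T (left_translate G (inv\<^bsub>G\<^esub> h) f) \<one>\<^bsub>H\<^esub> = T f h"
proof -
  have "inv\<^bsub>H\<^esub> h \<in> carrier H" using h by simp
  from intertwinerD(6)[OF T this f] show ?thesis
    using h by (simp add: inv_eq left_translate_def)
      (metis H.inv_inv H.r_one inv_eq H.inv_closed)
qed

lemma intertwiner_sum:
  assumes T: "T \<in> intertwiners G H (Ind G M A N \<xi> lam) \<H>"
    and f: "\<And>i. i \<in> I \<Longrightarrow> f i \<in> Ind G M A N \<xi> lam"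
  shows "T (\<lambda>x. \<Sum>i\<in>I. z i *s f i x) = (\<lambda>x. \<Sum>i\<in>I. z i *s T (f i) x)"
proof -
  have zero: "T (\<lambda>_. 0) = (\<lambda>_. 0)"
    using intertwinerD(4)[OF T G.Ind_zero, of 0] by simp
  show ?thesis
    using f
  proof (induction I rule: infinite_finite_induct)
    case (insert i I)
    then show ?case
      using intertwinerD(3)[OF T G.Ind_scale G.Ind_sum, of "f i" I f "z i" z] intertwinerD(4)[OF T]
      by simp
  qed (simp_all add: zero)
qed

text \<open>Membership of the sum lets a map defined by \<open>restrict\<close> be evaluated at it
  when linearity is checked.\<close>

lemma intertwiners_add:
  assumes sub: "\<H> = Ind H MH AH NH \<eta> \<nu>"
    and S: "S \<in> intertwiners G H \<F> \<H>" and T: "T \<in> intertwiners G H \<F> \<H>"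
  shows "(\<lambda>f x. S f x + T f x) \<in> intertwiners G H \<F> \<H>"
proof -
  have sm: "\<H> \<subseteq> smooth_functions H" unfolding sub by (rule H.Ind_smooth)
  note iff = H.continuous_map_Cinf_smooth_functions[OF sm]
  have mem: "(\<lambda>x. S f x + T f x) \<in> \<H>" if "f \<in> \<F>" for f
    using intertwinerD(2)[OF S that] intertwinerD(2)[OF T that] unfolding sub by (rule H.Ind_add)
  have "continuous_map (Cinf_topology G \<F>) (Cinf_topology H \<H>) (\<lambda>f x. S f x + T f x)"
    unfolding iff G.topspace_Cinf
    using intertwinerD(5)[OF S] intertwinerD(5)[OF T] mem
    by (auto simp: iff intro: H.continuous_map_Cinf_add)
  then show ?thesis
    using intertwinerD[OF S] intertwinerD[OF T] mem
    by (simp add: intertwiners_def fun_eq_iff left_translate_def vector_add_ldistrib add_ac)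
qed

lemma intertwiners_scale:
  assumes sub: "\<H> = Ind H MH AH NH \<eta> \<nu>" and T: "T \<in> intertwiners G H \<F> \<H>"
  shows "(\<lambda>f x. z *s T f x) \<in> intertwiners G H \<F> \<H>"
proof -
  have sm: "\<H> \<subseteq> smooth_functions H" unfolding sub by (rule H.Ind_smooth)
  note iff = H.continuous_map_Cinf_smooth_functions[OF sm]
  have mem: "(\<lambda>x. z *s T f x) \<in> \<H>" if "f \<in> \<F>" for f
    using intertwinerD(2)[OF T that] unfolding sub by (rule H.Ind_scale)
  \<comment> \<open>Scaling is multiplication by a constant smooth function, so its continuity is an
    instance of the bilinear case.\<close>
  have "(\<lambda>_. z) \<in> smooth_functions H" by (simp add: smooth_functions_def H.smooth_fun_const)
  from H.continuous_map_Cinf_bilinear[OF bounded_bilinear_scale_vec this]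
  have "continuous_map (Cinf_topology G \<F>) (Cinf_topology H \<H>) (\<lambda>f x. z *s T f x)"
    unfolding iff G.topspace_Cinf
    using intertwinerD(5)[OF T] mem by (auto simp: iff)
  then show ?thesis
    using intertwinerD[OF T] mem
    by (simp add: intertwiners_def fun_eq_iff left_translate_def vector_add_ldistrib
        vector_smult_assoc mult.commute)
qed

text \<open>Shows that the definite description denotes. Invariance of the value at the unit under
  P_H is the right equivariance of \<open>T f\<close> there, and setting \<open>h\<close> to the
  unit in the characterizing formula leaves no other candidate. The assumption on \<eta> is the
  inversion identity, in the form that \<open>tensor_rep_mult_one\<close> supplies for the
  target.\<close>

lemma dist_kernel_eq:
  assumes sub: "subgroup MH H" "subgroup AH H" "subgroup NH H"
    and \<eta>: "\<And>m. m \<in> MH \<Longrightarrow> \<eta> m ** \<eta> (inv\<^bsub>H\<^esub> m) = mat 1"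
    and \<F>: "\<And>f x. f \<in> \<F> \<Longrightarrow> x \<notin> carrier G \<Longrightarrow> f x = 0"
    and T: "T \<in> intertwiners G H \<F> (Ind H MH AH NH \<eta> \<nu>)"
  shows "dist_kernel G H MH AH NH \<eta> \<nu> \<F> T = (\<lambda>f. T f \<one>\<^bsub>H\<^esub>)"
  unfolding dist_kernel_def
proof (rule the_equality, intro conjI ballI)
  let ?K = "\<lambda>f. T f \<one>\<^bsub>H\<^esub>"
  note D = intertwinerD[OF T]
  have eval: "dist_translate G h ?K f = T f h" if "h \<in> carrier H" "f \<in> \<F>" for h f
    using intertwiner_at_one[OF T that(2,1)] by (simp add: dist_translate_def)
  then show "T f h = dist_translate G h ?K f" if "f \<in> \<F>" "h \<in> carrier H" for f h
    using that by simp
  have "continuous_map (Cinf_topology G \<F>) euclidean ?K"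
    using continuous_map_compose[OF D(5) H.continuous_map_Cinf_eval[OF H.Ind_smooth H.one_closed]]
    by (simp add: o_def)
  then have "?K \<in> distributions G \<F>"
    using D by (simp add: distributions_def)
  moreover have "man_action H AH \<eta> (\<lambda>X. \<nu> X + of_real (rho H NH X)) m a
      (dist_translate G (m \<otimes>\<^bsub>H\<^esub> a \<otimes>\<^bsub>H\<^esub> n) ?K f) = ?K f"
    if man: "m \<in> MH" "a \<in> AH" "n \<in> NH" and f: "f \<in> \<F>" for m a n f
  proof -
    have q: "m \<otimes>\<^bsub>H\<^esub> a \<otimes>\<^bsub>H\<^esub> n \<in> carrier H" using man sub by (simp add: subgroup.mem_carrier)
    have pw: "a_power H AH (\<lambda>X. \<nu> X + of_real (rho H NH X)) a
        * a_power H AH (\<lambda>X. - \<nu> X - of_real (rho H NH X)) a = 1"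
      by (simp add: a_power_mult) (simp add: a_power_def)
    have "T f (m \<otimes>\<^bsub>H\<^esub> a \<otimes>\<^bsub>H\<^esub> n)
      = a_power H AH (\<lambda>X. - \<nu> X - of_real (rho H NH X)) a *s (\<eta> (inv\<^bsub>H\<^esub> m) *v T f \<one>\<^bsub>H\<^esub>)"
      using H.Ind_equivariant[OF D(2)[OF f] H.one_closed man] q by simp
    then show ?thesis
      unfolding eval[OF q f] man_action_def
      by (simp add: vector_scalar_commute vector_smult_assoc pw matrix_vector_mul_assoc
          \<eta>[OF man(1)])
  qed
  ultimately show "?K \<in> invariant_distributions G H MH AH NH \<eta> \<nu> \<F>"
    by (simp add: invariant_distributions_def)
next
  fix K
  assume K: "K \<in> invariant_distributions G H MH AH NH \<eta> \<nu> \<F> \<and>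
    (\<forall>f\<in>\<F>. \<forall>h\<in>carrier H. T f h = dist_translate G h K f)"
  show "K = (\<lambda>f. T f \<one>\<^bsub>H\<^esub>)"
  proof
    fix f
    show "K f = T f \<one>\<^bsub>H\<^esub>"
    proof (cases "f \<in> \<F>")
      case True
      then have "T f \<one>\<^bsub>H\<^esub> = K (left_translate G (inv\<^bsub>G\<^esub> \<one>\<^bsub>H\<^esub>) f)"
        using K H.one_closed by (simp add: dist_translate_def)
      then show ?thesis using \<F>[OF True] by (simp add: one_eq G.left_translate_one)
    next
      case False
      \<comment> \<open>Off \<open>\<F>\<close> both sides vanish by the convention that
        distributions and intertwiners are extended by 0.\<close>
      then show ?thesis
        using K intertwinerD(1)[OF T] by (simp add: invariant_distributions_def distributions_def)
    qed
  qed
qed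

end

text \<open>Unlike the defining formula \<open>h \<mapsto> (\<phi> \<otimes> K\<^sup>T)(h\<^sup>-\<^sup>1 \<psi>)\<close>, this form makes smoothness in \<open>h\<close>
  evident.\<close>

definition transl_op ::
  "('g, 'a::euclidean_space) lie_struct \<Rightarrow> complex^'e^'e2 \<Rightarrow> ('g \<Rightarrow> complex^'e^'e) \<Rightarrow>
   complex^'e1^'e \<Rightarrow> ('g \<Rightarrow> complex^('v \<times> 'e1)) set \<Rightarrow>
   (('g \<Rightarrow> complex^'v) \<Rightarrow> 'g \<Rightarrow> complex^'w) \<Rightarrow>
   ('g \<Rightarrow> complex^('v \<times> 'e1)) \<Rightarrow> 'g \<Rightarrow> complex^('w \<times> 'e2)" where
  "transl_op G p \<tau> i \<F>' T \<psi> h = (if \<psi> \<in> \<F>' then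
     \<Sum>e\<in>UNIV. column_tensor e (p ** \<tau> (inv\<^bsub>G\<^esub> h)) (T (contract (transl_section G (mat 1) \<tau> i) e \<psi>) h)
     else 0)"

lemma contract_add: "contract \<phi> k (\<lambda>g. \<psi> g + \<psi>' g) = (\<lambda>g. contract \<phi> k \<psi> g + contract \<phi> k \<psi>' g)"
  by (simp add: contract_eq bounded_bilinear.add_right[OF bounded_bilinear_contract_at])

lemma contract_scale: "contract \<phi> k (\<lambda>g. z *s \<psi> g) = (\<lambda>g. z *s contract \<phi> k \<psi> g)"
  by (simp add: contract_def fun_eq_iff vec_eq_iff sum_distrib_left mult_ac)

lemma column_tensor_scale: "column_tensor e A (z *s y) = z *s column_tensor e A y"
  by (simp add: column_tensor_def vec_eq_iff)

lemma column_tensor_zero [simp]: "column_tensor e A 0 = 0"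
  by (simp add: column_tensor_def vec_eq_iff)

text \<open>Both sides are the image of the sum of the \<open>y e\<close> \<otimes> basis vectors
  under \<open>A ** B\<close> in the second factor; on the right, \<open>B\<close> has already acted
  on that tensor, which rearranges the coefficients \<open>y\<close>.\<close>

lemma sum_column_tensor_mult:
  "(\<Sum>e\<in>UNIV. column_tensor e (A ** B) (y e)) =
    (\<Sum>e\<in>UNIV. column_tensor e A (\<Sum>e'\<in>UNIV. B $ e $ e' *s y e'))"
  by (simp add: column_tensor_def matrix_matrix_mult_def vec_eq_iff sum_distrib_left
      sum_distrib_right mult_ac) (intro allI sum.swap)

lemma column_tensor_tensor_rep:
  "column_tensor e (\<sigma> m ** A) (\<eta> m *v y) = tensor_rep \<eta> \<sigma> m *v column_tensor e A y"
proof -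
  have "(tensor_rep \<eta> \<sigma> m *v column_tensor e A y) $ r = column_tensor e (\<sigma> m ** A) (\<eta> m *v y) $ r" for r
  proof -
    have "(tensor_rep \<eta> \<sigma> m *v column_tensor e A y) $ r
      = (\<Sum>a\<in>UNIV. \<Sum>b\<in>UNIV. \<eta> m $ fst r $ a * \<sigma> m $ snd r $ b * (A $ b $ e * y $ a))"
      unfolding sum_UNIV_prod[symmetric]
      by (simp add: matrix_vector_mult_def tensor_rep_def column_tensor_def)
    also have "\<dots> = (\<Sum>b\<in>UNIV. \<sigma> m $ snd r $ b * A $ b $ e) * (\<Sum>a\<in>UNIV. \<eta> m $ fst r $ a * y $ a)"
      by (simp add: sum_product mult_ac)
    finally show ?thesis
      by (simp add: column_tensor_def matrix_vector_mult_def matrix_matrix_mult_def)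
  qed
  then show ?thesis by (simp add: vec_eq_iff)
qed

lemma tensor_rep_mult_one:
  assumes "\<eta> m ** \<eta> m' = mat 1" "\<sigma> m ** \<sigma> m' = mat 1"
  shows "tensor_rep \<eta> \<sigma> m ** tensor_rep \<eta> \<sigma> m' = mat 1"
proof -
  have "(tensor_rep \<eta> \<sigma> m ** tensor_rep \<eta> \<sigma> m') $ r $ s
      = (\<eta> m ** \<eta> m') $ fst r $ fst s * (\<sigma> m ** \<sigma> m') $ snd r $ snd s" for r s
    by (simp add: tensor_rep_def matrix_matrix_mult_def sum_product mult_ac flip: sum_UNIV_prod)
  then show ?thesis
    unfolding assms by (auto simp: vec_eq_iff mat_def prod_eq_iff)
qed

section \<open>The translated operator\<close>

locale translation = closed_subgroup_pair G H
  for G :: "('g, 'a::euclidean_space) lie_struct" and H :: "('g, 'b::euclidean_space) lie_struct" +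
  fixes M A N MH AH NH :: "'g set"
    and \<tau> :: "'g \<Rightarrow> complex^'e^'e"
    and \<tau>' :: "'g \<Rightarrow> complex^'e1^'e1" and \<mu>' :: "'a \<Rightarrow> complex" and i :: "complex^'e1^'e"
    and \<tau>'' :: "'g \<Rightarrow> complex^'e2^'e2" and \<mu>'' :: "'b \<Rightarrow> complex" and p :: "complex^'e^'e2"
    and \<xi> :: "'g \<Rightarrow> complex^'v^'v" and \<eta> :: "'g \<Rightarrow> complex^'w^'w"
    and lam :: "'a \<Rightarrow> complex" and \<nu> :: "'b \<Rightarrow> complex"
  assumes sub: "subgroup M G" "subgroup A G" "subgroup N G"
    and subH: "subgroup MH H" "subgroup AH H" "subgroup NH H"
    and \<tau>: "fin_rep G (carrier G) \<tau>" and \<tau>': "fin_rep G M \<tau>'"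
    and \<tau>'': "fin_rep H MH \<tau>''" and \<eta>: "fin_rep H MH \<eta>"
    and i_equivariant: "m \<in> M \<Longrightarrow> a \<in> A \<Longrightarrow> n \<in> N \<Longrightarrow>
          \<tau> (m \<otimes>\<^bsub>G\<^esub> a \<otimes>\<^bsub>G\<^esub> n) *v (i *v x) = i *v man_action G A \<tau>' \<mu>' m a x"
    and p_equivariant: "m \<in> MH \<Longrightarrow> a \<in> AH \<Longrightarrow> n \<in> NH \<Longrightarrow>
          p *v (\<tau> (m \<otimes>\<^bsub>H\<^esub> a \<otimes>\<^bsub>H\<^esub> n) *v y) = man_action H AH \<tau>'' \<mu>'' m a (p *v y)"
begin

abbreviation \<F> where "\<F> \<equiv> Ind G M A N \<xi> lam"
abbreviation \<H> where "\<H> \<equiv> Ind H MH AH NH \<eta> \<nu>"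
abbreviation \<F>' where "\<F>' \<equiv> Ind G M A N (tensor_rep \<xi> \<tau>') (\<lambda>X. lam X + \<mu>' X)"
abbreviation \<H>' where "\<H>' \<equiv> Ind H MH AH NH (tensor_rep \<eta> \<tau>'') (\<lambda>X. \<nu> X + \<mu>'' X)"
abbreviation comp where "comp e \<psi> \<equiv> contract (transl_section G (mat 1) \<tau> i) e \<psi>"
abbreviation \<Theta> where "\<Theta> \<equiv> transl_op G p \<tau> i \<F>'"

lemma \<tau>_mult: "x \<in> carrier G \<Longrightarrow> y \<in> carrier G \<Longrightarrow> \<tau> (x \<otimes>\<^bsub>G\<^esub> y) = \<tau> x ** \<tau> y"
  using \<tau> by (simp add: fin_rep_def)

lemma hom_section: "transl_section G q \<tau> i \<in> hom_sections G M A N \<tau>' \<mu>'"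
  by (rule G.transl_section_hom_sections[OF \<tau> sub i_equivariant])

lemma comp_Ind: "\<psi> \<in> \<F>' \<Longrightarrow> comp e \<psi> \<in> \<F>"
  by (rule G.contract_Ind[OF hom_section \<tau>' sub(1)])

text \<open>\<tau> is pulled back along the smooth inclusion of H and then along the inversion of H,
  which is that of G on \<open>carrier H\<close>.\<close>

lemma smooth_\<tau>_inv: "(\<lambda>h. p ** \<tau> (inv\<^bsub>G\<^esub> h)) \<in> smooth_functions H"
proof -
  have "smooth_fun G (carrier G) \<tau>"
    using \<tau> by (intro G.smooth_on_subset_carrier) (simp add: fin_rep_def)
  then have "smooth_fun H (carrier H) \<tau>"
    by (rule H.smooth_fun_compose[OF G.lie_group_axioms smooth_inclusion])
  then have "smooth_fun H (carrier H) (\<lambda>h. \<tau> (inv\<^bsub>H\<^esub> h))"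
    by (rule H.smooth_fun_compose[OF H.lie_group_axioms H.smooth_inv])
  moreover have "bounded_linear (\<lambda>T :: complex^'e^'e. p ** T)"
    unfolding linear_conv_bounded_linear[symmetric]
    by (rule linearI)
      (simp_all add: vec_eq_iff matrix_matrix_mult_def algebra_simps sum.distrib scaleR_sum_right)
  ultimately have "smooth_fun H (carrier H) (\<lambda>h. p ** \<tau> (inv\<^bsub>H\<^esub> h))"
    using H.smooth_fun_linear by blast
  then show ?thesis
    unfolding smooth_functions_def mem_Collect_eq by (rule H.smooth_fun_cong) (simp add: inv_eq)
qed

text \<open>The inverse of \<open>m a n\<close> has its factors in the reverse order, so
  equivariance of \<open>p\<close> is not applied to it directly. It is applied to
  \<open>m a n\<close> at the vector \<open>\<tau>(q)^-1 x\<close>, and the resulting equation is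
  solved for the image under \<open>p\<close>.\<close>

lemma p_equivariant_inv:
  assumes man: "m \<in> MH" "a \<in> AH" "n \<in> NH"
  shows "p ** \<tau> (inv\<^bsub>G\<^esub> (m \<otimes>\<^bsub>H\<^esub> a \<otimes>\<^bsub>H\<^esub> n)) *v x =
    a_power H AH (\<lambda>X. - \<mu>'' X) a *s (\<tau>'' (inv\<^bsub>H\<^esub> m) ** p *v x)"
proof -
  let ?q = "m \<otimes>\<^bsub>H\<^esub> a \<otimes>\<^bsub>H\<^esub> n"
  have q: "?q \<in> carrier G"
    using man subH carrier_subset by (meson H.m_closed subgroup.mem_carrier subsetD)
  define y where "y = \<tau> (inv\<^bsub>G\<^esub> ?q) *v x"
  have "\<tau> ?q *v y = x"
    unfolding y_def using G.fin_rep_inv[OF \<tau> G.subgroup_self q] by (simp add: matrix_vector_mul_assoc)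
  then have "p *v x = a_power H AH \<mu>'' a *s (\<tau>'' m *v (p *v y))"
    using p_equivariant[OF man, of y] by (simp add: man_action_def)
  moreover have "\<tau>'' (inv\<^bsub>H\<^esub> m) *v (\<tau>'' m *v z) = z" for z
    by (simp add: matrix_vector_mul_assoc H.fin_rep_inv[OF \<tau>'' subH(1) man(1)])
  ultimately have "\<tau>'' (inv\<^bsub>H\<^esub> m) *v (p *v x) = a_power H AH \<mu>'' a *s (p *v y)"
    by (simp only: vector_scalar_commute)
  then show ?thesis
    by (simp add: vector_smult_assoc a_power_uminus y_def flip: matrix_vector_mul_assoc)
qed

text \<open>Inversion reverses products, so the factor from P_H lands next to \<open>p\<close> and
  yields the inverse of \<tau>'' and of the \<mu>''-power. Equivariance of \<open>T\<close> on the
  components yields the \<eta>-part with the shift by \<rho> of H.\<close>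

lemma transl_op_Ind:
  assumes T: "T \<in> intertwiners G H \<F> \<H>" and \<psi>: "\<psi> \<in> \<F>'"
  shows "\<Theta> T \<psi> \<in> \<H>'"
proof (rule H.IndI)
  note Tc = intertwinerD(2)[OF T comp_Ind[OF \<psi>]]
  show "\<Theta> T \<psi> x = 0" if "x \<notin> carrier H" for x
    by (simp add: transl_op_def H.Ind_outside[OF Tc that])
  have "smooth_fun H (carrier H) (\<lambda>h. \<Sum>e\<in>UNIV. column_tensor e (p ** \<tau> (inv\<^bsub>G\<^esub> h)) (T (comp e \<psi>) h))"
    using smooth_\<tau>_inv Tc
    by (intro H.smooth_fun_sum H.smooth_fun_bilinear[OF bounded_bilinear_column_tensor])
      (simp_all add: smooth_functions_def Ind_def)
  then show "smooth_fun H (carrier H) (\<Theta> T \<psi>)"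
    by (rule H.smooth_fun_cong) (simp add: transl_op_def \<psi>)
  fix h m a n assume h: "h \<in> carrier H" and man: "m \<in> MH" "a \<in> AH" "n \<in> NH"
  let ?q = "m \<otimes>\<^bsub>H\<^esub> a \<otimes>\<^bsub>H\<^esub> n"
  have q: "?q \<in> carrier H"
    using man subH by (meson H.m_closed subgroup.mem_carrier)
  have hG: "h \<in> carrier G" "?q \<in> carrier G" using h q carrier_subset by auto
  define c1 where "c1 = a_power H AH (\<lambda>X. - \<mu>'' X) a"
  define c2 where "c2 = a_power H AH (\<lambda>X. - \<nu> X - of_real (rho H NH X)) a"
  have c: "c1 * c2 = a_power H AH (\<lambda>X. - (\<nu> X + \<mu>'' X) - of_real (rho H NH X)) a"
    unfolding c1_def c2_def a_power_mult by (simp add: algebra_simps)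
  have "\<tau> (inv\<^bsub>G\<^esub> (h \<otimes>\<^bsub>H\<^esub> ?q)) = \<tau> (inv\<^bsub>G\<^esub> ?q) ** \<tau> (inv\<^bsub>G\<^esub> h)"
    using hG by (simp add: mult_eq[OF h q] G.inv_mult_group \<tau>_mult)
  then have "p ** \<tau> (inv\<^bsub>G\<^esub> (h \<otimes>\<^bsub>H\<^esub> ?q)) *v x =
      c1 *s (\<tau>'' (inv\<^bsub>H\<^esub> m) ** (p ** \<tau> (inv\<^bsub>G\<^esub> h)) *v x)" for x
    using p_equivariant_inv[OF man, of "\<tau> (inv\<^bsub>G\<^esub> h) *v x"]
    by (simp add: c1_def matrix_vector_mul_assoc matrix_mul_assoc)
  then have entry: "(p ** \<tau> (inv\<^bsub>G\<^esub> (h \<otimes>\<^bsub>H\<^esub> ?q))) $ k $ e =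
      c1 * (\<tau>'' (inv\<^bsub>H\<^esub> m) ** (p ** \<tau> (inv\<^bsub>G\<^esub> h))) $ k $ e" for k e
    by (simp add: matrix_eq_component)
  have "column_tensor e (p ** \<tau> (inv\<^bsub>G\<^esub> (h \<otimes>\<^bsub>H\<^esub> ?q))) (T (comp e \<psi>) (h \<otimes>\<^bsub>H\<^esub> ?q))
    = (c1 * c2) *s column_tensor e (\<tau>'' (inv\<^bsub>H\<^esub> m) ** (p ** \<tau> (inv\<^bsub>G\<^esub> h)))
        (\<eta> (inv\<^bsub>H\<^esub> m) *v T (comp e \<psi>) h)" for e
    by (simp add: column_tensor_def vec_eq_iff entry H.Ind_equivariant[OF Tc h man] c2_def)
  also have "\<dots> e = (c1 * c2) *s (tensor_rep \<eta> \<tau>'' (inv\<^bsub>H\<^esub> m) *v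
      column_tensor e (p ** \<tau> (inv\<^bsub>G\<^esub> h)) (T (comp e \<psi>) h))" for e
    by (simp add: column_tensor_tensor_rep)
  finally have "\<Theta> T \<psi> (h \<otimes>\<^bsub>H\<^esub> ?q) = (c1 * c2) *s (tensor_rep \<eta> \<tau>'' (inv\<^bsub>H\<^esub> m) *v \<Theta> T \<psi> h)"
    by (simp add: transl_op_def \<psi> linear_sum[OF matrix_vector_mul_linear]
        bounded_bilinear.sum_right[OF bounded_bilinear_scale_vec])
  then show "\<Theta> T \<psi> (h \<otimes>\<^bsub>H\<^esub> ?q) =
      a_power H AH (\<lambda>X. - (\<nu> X + \<mu>'' X) - of_real (rho H NH X)) a *s
        (tensor_rep \<eta> \<tau>'' (inv\<^bsub>H\<^esub> m) *v \<Theta> T \<psi> h)"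
    by (simp only: c)
qed

lemma continuous_transl_op:
  assumes T: "T \<in> intertwiners G H \<F> \<H>"
  shows "continuous_map (Cinf_topology G \<F>') (Cinf_topology H \<H>') (\<Theta> T)"
proof -
  let ?X = "Cinf_topology G \<F>'"
  \<comment> \<open>The inclusion of the induced space into all smooth functions, needed to start
    the chain in the ambient topology.\<close>
  have id: "continuous_map ?X (Cinf_topology G (smooth_functions G)) (\<lambda>\<psi>. \<psi>)"
  proof -
    have "continuous_map ?X ?X (\<lambda>\<psi>. \<psi>)" by simp
    then show ?thesis
      unfolding G.continuous_map_Cinf_smooth_functions[OF G.Ind_smooth] by blast
  qed
  have \<phi>: "transl_section G (mat 1) \<tau> i \<in> smooth_functions G"
    using hom_section by (auto simp: hom_sections_def smooth_functions_def)
  have "continuous_map ?X (Cinf_topology G (smooth_functions G)) (comp e)" for e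
    unfolding contract_eq by (rule G.continuous_map_Cinf_bilinear[OF bounded_bilinear_contract_at \<phi> id])
  then have "continuous_map ?X (Cinf_topology G \<F>) (comp e)" for e
    unfolding G.continuous_map_Cinf_smooth_functions[OF G.Ind_smooth] G.topspace_Cinf
    using comp_Ind by blast
  then have "continuous_map ?X (Cinf_topology H \<H>) (T \<circ> comp e)" for e
    by (rule continuous_map_compose[OF _ intertwinerD(5)[OF T]])
  then have "continuous_map ?X (Cinf_topology H (smooth_functions H)) (\<lambda>\<psi>. T (comp e \<psi>))" for e
    unfolding H.continuous_map_Cinf_smooth_functions[OF H.Ind_smooth] o_def by blast
  then have "continuous_map ?X (Cinf_topology H (smooth_functions H))
      (\<lambda>\<psi> h. \<Sum>e\<in>UNIV. column_tensor e (p ** \<tau> (inv\<^bsub>G\<^esub> h)) (T (comp e \<psi>) h))"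
    by (intro H.continuous_map_Cinf_sum
        H.continuous_map_Cinf_bilinear[OF bounded_bilinear_column_tensor smooth_\<tau>_inv])
  then have "continuous_map ?X (Cinf_topology H (smooth_functions H)) (\<Theta> T)"
    by (rule continuous_map_eq) (simp add: G.topspace_Cinf transl_op_def fun_eq_iff)
  then show ?thesis
    unfolding H.continuous_map_Cinf_smooth_functions[OF H.Ind_smooth] G.topspace_Cinf
    using transl_op_Ind[OF T] by blast
qed

text \<open>Translation mixes the components by \<open>\<tau> h\<close>. Moving this matrix over to
  the other tensor factor gives \<open>p ** \<tau> (inv x) ** \<tau> h\<close>, which is the
  coefficient belonging to the translated point.\<close>

lemma transl_op_left_translate:
  assumes T: "T \<in> intertwiners G H \<F> \<H>" and \<psi>: "\<psi> \<in> \<F>'" and h: "h \<in> carrier H"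
  shows "\<Theta> T (left_translate G h \<psi>) = left_translate H h (\<Theta> T \<psi>)"
proof
  fix x
  have hG: "h \<in> carrier G" using h carrier_subset by auto
  have h\<psi>: "left_translate G h \<psi> \<in> \<F>'" by (rule G.Ind_left_translate[OF \<psi> hG sub])
  have Tc: "T (comp e \<psi>) \<in> \<H>" "T (comp e (left_translate G h \<psi>)) \<in> \<H>" for e
    using intertwinerD(2)[OF T comp_Ind] \<psi> h\<psi> by blast+
  show "\<Theta> T (left_translate G h \<psi>) x = left_translate H h (\<Theta> T \<psi>) x"
  proof (cases "x \<in> carrier H")
    case False
    have "\<Theta> T (left_translate G h \<psi>) x = 0"
      by (simp add: transl_op_def H.Ind_outside[OF Tc(2) False])
    then show ?thesis using False by (simp add: left_translate_def)
  next
    case True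
    then have xG: "x \<in> carrier G" using carrier_subset by auto
    have "T (comp e (left_translate G h \<psi>)) x
        = (\<Sum>e'\<in>UNIV. \<tau> h $ e $ e' *s T (comp e' \<psi>) (inv\<^bsub>H\<^esub> h \<otimes>\<^bsub>H\<^esub> x))" for e
    proof -
      have "T (comp e (left_translate G h \<psi>))
          = (\<lambda>x. \<Sum>e'\<in>UNIV. \<tau> h $ e $ e' *s T (left_translate G h (comp e' \<psi>)) x)"
        unfolding G.contract_transl_section[OF \<tau> hG]
        using intertwiner_sum[OF T, where f = "\<lambda>e'. left_translate G h (comp e' \<psi>)" and I = UNIV
            and z = "\<lambda>e'. \<tau> h $ e $ e'", OF G.Ind_left_translate[OF comp_Ind[OF \<psi>] hG sub]] by simp
      moreover have "left_translate H h f x = f (inv\<^bsub>H\<^esub> h \<otimes>\<^bsub>H\<^esub> x)" for f :: "'g \<Rightarrow> complex^'w"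
        using True by (simp add: left_translate_def)
      ultimately show ?thesis
        by (simp only: intertwinerD(6)[OF T h comp_Ind[OF \<psi>]])
    qed
    then have "\<Theta> T (left_translate G h \<psi>) x = (\<Sum>e\<in>UNIV. column_tensor e
        (p ** \<tau> (inv\<^bsub>G\<^esub> x) ** \<tau> h) (T (comp e \<psi>) (inv\<^bsub>H\<^esub> h \<otimes>\<^bsub>H\<^esub> x)))"
      by (simp add: transl_op_def h\<psi> sum_column_tensor_mult)
    moreover have "p ** \<tau> (inv\<^bsub>G\<^esub> x) ** \<tau> h = p ** \<tau> (inv\<^bsub>G\<^esub> (inv\<^bsub>H\<^esub> h \<otimes>\<^bsub>H\<^esub> x))"
      unfolding mult_eq[OF H.inv_closed[OF h] True, unfolded inv_eq[OF h]] inv_eq[OF h]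
      using hG xG by (simp add: G.inv_mult_group \<tau>_mult matrix_mul_assoc)
    ultimately show ?thesis
      using True by (simp add: transl_op_def \<psi> left_translate_def)
  qed
qed

lemma transl_op_intertwiner:
  assumes T: "T \<in> intertwiners G H \<F> \<H>"
  shows "\<Theta> T \<in> intertwiners G H \<F>' \<H>'"
proof -
  have "\<Theta> T (\<lambda>x. f x + f' x) = (\<lambda>x. \<Theta> T f x + \<Theta> T f' x)" if f: "f \<in> \<F>'" "f' \<in> \<F>'" for f f'
    by (simp add: transl_op_def fun_eq_iff f G.Ind_add[OF f] contract_add
        intertwinerD(3)[OF T comp_Ind[OF f(1)] comp_Ind[OF f(2)]] sum.distrib
        bounded_bilinear.add_right[OF bounded_bilinear_column_tensor])
  moreover have "\<Theta> T (\<lambda>x. z *s f x) = (\<lambda>x. z *s \<Theta> T f x)" if f: "f \<in> \<F>'" for f z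
    by (simp add: transl_op_def fun_eq_iff f G.Ind_scale[OF f] contract_scale
        intertwinerD(4)[OF T comp_Ind[OF f]] column_tensor_scale
        bounded_bilinear.sum_right[OF bounded_bilinear_scale_vec])
  moreover have "\<Theta> T f = (\<lambda>_. 0)" if "f \<notin> \<F>'" for f
    using that by (simp add: transl_op_def fun_eq_iff)
  ultimately show ?thesis
    using transl_op_Ind[OF T] continuous_transl_op[OF T] transl_op_left_translate[OF T]
    by (simp add: intertwiners_def)
qed

text \<open>At the unit the coefficient matrix is \<open>p\<close> itself. Linearity of
  \<open>T\<close> then recombines the components into the pairing with \<phi>, which is the
  transpose defining \<open>section_mult\<close>.\<close>

lemma transl_op_at_one:
  assumes T: "T \<in> intertwiners G H \<F> \<H>"
  shows "\<Theta> T \<psi> \<one>\<^bsub>H\<^esub> = section_mult \<F>' (transl_section G p \<tau> i) (\<lambda>f. T f \<one>\<^bsub>H\<^esub>) \<psi>"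
proof (cases "\<psi> \<in> \<F>'")
  case \<psi>: True
  have one: "\<tau> \<one>\<^bsub>G\<^esub> = mat 1" using \<tau> by (simp add: fin_rep_def)
  have "left_translate G \<one>\<^bsub>G\<^esub> \<psi> = \<psi>" "left_translate G \<one>\<^bsub>G\<^esub> (comp e \<psi>) = comp e \<psi>" for e
    using G.Ind_outside[OF \<psi>] G.Ind_outside[OF comp_Ind[OF \<psi>]] by (auto intro: G.left_translate_one)
  then have "contract (transl_section G p \<tau> i) k \<psi> = (\<lambda>g. \<Sum>e\<in>UNIV. p $ k $ e *s comp e \<psi> g)" for k
    using G.contract_transl_section[OF \<tau> G.one_closed, of p i k \<psi>] by (simp add: one)
  then have "T (contract (transl_section G p \<tau> i) k \<psi>) \<one>\<^bsub>H\<^esub>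
      = (\<Sum>e\<in>UNIV. p $ k $ e *s T (comp e \<psi>) \<one>\<^bsub>H\<^esub>)" for k
    using intertwiner_sum[OF T, where f = "\<lambda>e. comp e \<psi>" and I = UNIV and z = "\<lambda>e. p $ k $ e",
        OF comp_Ind[OF \<psi>]] by simp
  then show ?thesis
    by (simp add: transl_op_def section_mult_def \<psi> one_eq one vec_eq_iff column_tensor_def)
qed (simp add: transl_op_def section_mult_def)

lemma dist_kernel_at_one:
  assumes "T \<in> intertwiners G H \<F> \<H>"
  shows "dist_kernel G H MH AH NH \<eta> \<nu> \<F> T = (\<lambda>f. T f \<one>\<^bsub>H\<^esub>)"
  by (rule dist_kernel_eq[OF subH H.fin_rep_inv(1)[OF \<eta> subH(1)] _ assms])
    (auto intro: G.Ind_outside)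

lemma dist_kernel_at_one':
  assumes "S \<in> intertwiners G H \<F>' \<H>'"
  shows "dist_kernel G H MH AH NH (tensor_rep \<eta> \<tau>'') (\<lambda>X. \<nu> X + \<mu>'' X) \<F>' S = (\<lambda>f. S f \<one>\<^bsub>H\<^esub>)"
  by (rule dist_kernel_eq[OF subH tensor_rep_mult_one[where m' = "inv\<^bsub>H\<^esub> _"] _ assms])
    (rule H.fin_rep_inv(1)[OF \<eta> subH(1)] H.fin_rep_inv(1)[OF \<tau>'' subH(1)] G.Ind_outside; assumption)+

lemma intertwiner_eqI:
  assumes S: "S \<in> intertwiners G H \<F>' \<H>'" and T: "T \<in> intertwiners G H \<F>' \<H>'"
    and eq: "\<And>\<psi>. S \<psi> \<one>\<^bsub>H\<^esub> = T \<psi> \<one>\<^bsub>H\<^esub>"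
  shows "S = T"
proof (intro ext)
  fix \<psi> h
  show "S \<psi> h = T \<psi> h"
  proof (cases "\<psi> \<in> \<F>'")
    case \<psi>: True
    show ?thesis
    proof (cases "h \<in> carrier H")
      case True
      then show ?thesis
        using intertwiner_at_one[OF S \<psi> True] intertwiner_at_one[OF T \<psi> True] eq by metis
    qed (simp add: H.Ind_outside[OF intertwinerD(2)[OF S \<psi>]] H.Ind_outside[OF intertwinerD(2)[OF T \<psi>]])
  qed (simp add: intertwinerD(1)[OF S] intertwinerD(1)[OF T])
qed

lemma linear_transl_op:
  "linear_on_intertwiners (intertwiners G H \<F> \<H>) (restrict \<Theta> (intertwiners G H \<F> \<H>))"
  unfolding linear_on_intertwiners_def
proof (intro conjI ballI allI)
  have "\<Theta> (\<lambda>f x. S f x + T f x) = (\<lambda>\<psi> x. \<Theta> S \<psi> x + \<Theta> T \<psi> x)" for S T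
    by (simp add: transl_op_def fun_eq_iff sum.distrib
        bounded_bilinear.add_right[OF bounded_bilinear_column_tensor])
  then show "restrict \<Theta> (intertwiners G H \<F> \<H>) (\<lambda>f x. S f x + T f x) =
      (\<lambda>f x. restrict \<Theta> (intertwiners G H \<F> \<H>) S f x + restrict \<Theta> (intertwiners G H \<F> \<H>) T f x)"
    if "S \<in> intertwiners G H \<F> \<H>" "T \<in> intertwiners G H \<F> \<H>" for S T
    \<comment> \<open>The operators are additive by computation; closure of the intertwiners under
      sums is what unfolds \<open>restrict\<close> at the sum.\<close>
    unfolding restrict_apply'[OF that(1)] restrict_apply'[OF that(2)]
      restrict_apply'[OF intertwiners_add[OF refl that]] .
  have "\<Theta> (\<lambda>f x. z *s T f x) = (\<lambda>\<psi> x. z *s \<Theta> T \<psi> x)" for z T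
    by (simp add: transl_op_def fun_eq_iff column_tensor_scale
        bounded_bilinear.sum_right[OF bounded_bilinear_scale_vec])
  then show "restrict \<Theta> (intertwiners G H \<F> \<H>) (\<lambda>f x. z *s T f x) =
      (\<lambda>f x. z *s restrict \<Theta> (intertwiners G H \<F> \<H>) T f x)"
    if "T \<in> intertwiners G H \<F> \<H>" for z T
    unfolding restrict_apply'[OF that] restrict_apply'[OF intertwiners_scale[OF refl that]] .
qed

text \<open>In the extensional function space a map is determined by its values at intertwiners. The
  kernel identity prescribes each value as an operator evaluated at the unit, hence the
  operator.\<close>

lemma ex1_translation:
  "\<exists>!\<Phi>. \<Phi> \<in> intertwiners G H \<F> \<H> \<rightarrow>\<^sub>E intertwiners G H \<F>' \<H>' \<and>
     linear_on_intertwiners (intertwiners G H \<F> \<H>) \<Phi> \<and>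
     (\<forall>T \<in> intertwiners G H \<F> \<H>.
        dist_kernel G H MH AH NH (tensor_rep \<eta> \<tau>'') (\<lambda>X. \<nu> X + \<mu>'' X) \<F>' (\<Phi> T) =
        section_mult \<F>' (transl_section G p \<tau> i) (dist_kernel G H MH AH NH \<eta> \<nu> \<F> T))"
proof (rule ex1I)
  show "restrict \<Theta> (intertwiners G H \<F> \<H>) \<in> intertwiners G H \<F> \<H> \<rightarrow>\<^sub>E intertwiners G H \<F>' \<H>' \<and>
     linear_on_intertwiners (intertwiners G H \<F> \<H>) (restrict \<Theta> (intertwiners G H \<F> \<H>)) \<and>
     (\<forall>T \<in> intertwiners G H \<F> \<H>.
        dist_kernel G H MH AH NH (tensor_rep \<eta> \<tau>'') (\<lambda>X. \<nu> X + \<mu>'' X) \<F>'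
          (restrict \<Theta> (intertwiners G H \<F> \<H>) T) =
        section_mult \<F>' (transl_section G p \<tau> i) (dist_kernel G H MH AH NH \<eta> \<nu> \<F> T))"
  proof (intro conjI ballI)
    show "restrict \<Theta> (intertwiners G H \<F> \<H>) \<in> intertwiners G H \<F> \<H> \<rightarrow>\<^sub>E intertwiners G H \<F>' \<H>'"
      by (rule restrict_PiE_iff[THEN iffD2]) (rule ballI, rule transl_op_intertwiner)
    fix T assume T: "T \<in> intertwiners G H \<F> \<H>"
    show "dist_kernel G H MH AH NH (tensor_rep \<eta> \<tau>'') (\<lambda>X. \<nu> X + \<mu>'' X) \<F>'
        (restrict \<Theta> (intertwiners G H \<F> \<H>) T) =
      section_mult \<F>' (transl_section G p \<tau> i) (dist_kernel G H MH AH NH \<eta> \<nu> \<F> T)"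
      unfolding restrict_apply'[OF T] dist_kernel_at_one[OF T]
        dist_kernel_at_one'[OF transl_op_intertwiner[OF T]]
      by (rule ext) (rule transl_op_at_one[OF T])
  qed (rule linear_transl_op)
next
  fix \<Phi>
  assume \<Phi>: "\<Phi> \<in> intertwiners G H \<F> \<H> \<rightarrow>\<^sub>E intertwiners G H \<F>' \<H>' \<and>
     linear_on_intertwiners (intertwiners G H \<F> \<H>) \<Phi> \<and>
     (\<forall>T \<in> intertwiners G H \<F> \<H>.
        dist_kernel G H MH AH NH (tensor_rep \<eta> \<tau>'') (\<lambda>X. \<nu> X + \<mu>'' X) \<F>' (\<Phi> T) =
        section_mult \<F>' (transl_section G p \<tau> i) (dist_kernel G H MH AH NH \<eta> \<nu> \<F> T))"
  show "\<Phi> = restrict \<Theta> (intertwiners G H \<F> \<H>)"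
  proof (rule PiE_ext)
    show "\<Phi> \<in> intertwiners G H \<F> \<H> \<rightarrow>\<^sub>E intertwiners G H \<F>' \<H>'" by (rule conjunct1[OF \<Phi>])
    show "restrict \<Theta> (intertwiners G H \<F> \<H>) \<in> intertwiners G H \<F> \<H> \<rightarrow>\<^sub>E intertwiners G H \<F>' \<H>'"
      by (rule restrict_PiE_iff[THEN iffD2]) (rule ballI, rule transl_op_intertwiner)
    fix T assume T: "T \<in> intertwiners G H \<F> \<H>"
    have \<Phi>T: "\<Phi> T \<in> intertwiners G H \<F>' \<H>'" by (rule PiE_mem[OF conjunct1[OF \<Phi>] T])
    have "(\<lambda>\<psi>. \<Phi> T \<psi> \<one>\<^bsub>H\<^esub>) = section_mult \<F>' (transl_section G p \<tau> i) (\<lambda>f. T f \<one>\<^bsub>H\<^esub>)"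
      using conjunct2[OF conjunct2[OF \<Phi>], rule_format, OF T]
      unfolding dist_kernel_at_one'[OF \<Phi>T] dist_kernel_at_one[OF T] .
    then have "\<Phi> T = \<Theta> T"
      by (intro intertwiner_eqI[OF \<Phi>T transl_op_intertwiner[OF T]])
        (simp add: transl_op_at_one[OF T] fun_eq_iff)
    then show "\<Phi> T = restrict \<Theta> (intertwiners G H \<F> \<H>) T" using T by simp
  qed
qed

end


theorem theorem1:
  fixes G :: "('g, 'a::euclidean_space) lie_struct"
    and H :: "('g, 'b::euclidean_space) lie_struct"
    and P M A N PH MH AH NH :: "'g set"
    and \<tau> :: "'g \<Rightarrow> complex^'e^'e"
    and \<tau>' :: "'g \<Rightarrow> complex^'e1^'e1" and \<mu>' :: "'a \<Rightarrow> real" and i :: "complex^'e1^'e"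
    and \<tau>'' :: "'g \<Rightarrow> complex^'e2^'e2" and \<mu>'' :: "'b \<Rightarrow> complex" and p :: "complex^'e^'e2"
    and \<xi> :: "'g \<Rightarrow> complex^'v^'v" and \<eta> :: "'g \<Rightarrow> complex^'w^'w"
    and lam :: "'a \<Rightarrow> complex" and \<nu> :: "'b \<Rightarrow> complex"
  assumes G: "real_reductive G" and H: "reductive_subgroup H G"
    and P: "parabolic_subgroup G P M A N" and PH: "parabolic_subgroup H PH MH AH NH"
    and \<tau>: "irreducible_rep G (carrier G) \<tau>"
    and E'_irreducible: "irreducible_subrep P \<tau> (range (\<lambda>x. i *v x))"
    and E'_unique: "\<And>F. irreducible_subrep P \<tau> F \<Longrightarrow> F = range (\<lambda>x. i *v x)"
    and i_inj: "inj (\<lambda>x. i *v x)"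
    and \<tau>': "irreducible_rep G M \<tau>'" and \<mu>': "linear \<mu>'"
    and i_equivariant: "\<And>m a n x. m \<in> M \<Longrightarrow> a \<in> A \<Longrightarrow> n \<in> N \<Longrightarrow>
          \<tau> (m \<otimes>\<^bsub>G\<^esub> a \<otimes>\<^bsub>G\<^esub> n) *v (i *v x) = i *v man_action G A \<tau>' (\<lambda>X. of_real (\<mu>' X)) m a x"
    and \<xi>: "fin_rep G M \<xi>" and \<eta>: "fin_rep H MH \<eta>"
    and lam: "linear lam" and \<nu>: "linear \<nu>"
    and \<tau>'': "fin_rep H MH \<tau>''" and \<mu>'': "linear \<mu>''"
    and p_surj: "surj (\<lambda>x. p *v x)"
    and p_equivariant: "\<And>m a n x. m \<in> MH \<Longrightarrow> a \<in> AH \<Longrightarrow> n \<in> NH \<Longrightarrow>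
          p *v (\<tau> (m \<otimes>\<^bsub>H\<^esub> a \<otimes>\<^bsub>H\<^esub> n) *v x) = man_action H AH \<tau>'' \<mu>'' m a (p *v x)"
  defines "\<F> \<equiv> Ind G M A N \<xi> lam"
    and "\<H> \<equiv> Ind H MH AH NH \<eta> \<nu>"
    and "\<F>' \<equiv> Ind G M A N (tensor_rep \<xi> \<tau>') (\<lambda>X. lam X + of_real (\<mu>' X))"
    and "\<H>' \<equiv> Ind H MH AH NH (tensor_rep \<eta> \<tau>'') (\<lambda>X. \<nu> X + \<mu>'' X)"
    and "\<phi> \<equiv> transl_section G p \<tau> i"
  shows "\<phi> \<in> hom_sections G M A N \<tau>' (\<lambda>X. of_real (\<mu>' X)) \<and>
    (\<exists>!\<Phi>. \<Phi> \<in> intertwiners G H \<F> \<H> \<rightarrow>\<^sub>E intertwiners G H \<F>' \<H>' \<and>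
       linear_on_intertwiners (intertwiners G H \<F> \<H>) \<Phi> \<and>
       (\<forall>T \<in> intertwiners G H \<F> \<H>.
          dist_kernel G H MH AH NH (tensor_rep \<eta> \<tau>'') (\<lambda>X. \<nu> X + \<mu>'' X) \<F>' (\<Phi> T) =
          section_mult \<F>' \<phi> (dist_kernel G H MH AH NH \<eta> \<nu> \<F> T)))"
proof -
  have "lie_group G"
    using G unfolding real_reductive_def reductive_structure_def by (elim exE conjE)
  moreover have "lie_group H" "subgroup (carrier H) G" "smooth_map H G (\<lambda>x. x)"
    "\<forall>x\<in>carrier H. \<forall>y\<in>carrier H. x \<otimes>\<^bsub>H\<^esub> y = x \<otimes>\<^bsub>G\<^esub> y"
    using H unfolding reductive_subgroup_def closed_lie_subgroup_def by blast+
  ultimately interpret closed_subgroup_pair G H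
    by (simp add: closed_subgroup_pair_def closed_subgroup_pair_axioms_def subgroup.subset)
  have sub: "subgroup M G" "subgroup A G" "subgroup N G"
    using P unfolding parabolic_subgroup_def by blast+
  have subH: "subgroup MH H" "subgroup AH H" "subgroup NH H"
    using PH unfolding parabolic_subgroup_def by blast+
  have reps: "fin_rep G (carrier G) \<tau>" "fin_rep G M \<tau>'"
    using \<tau> \<tau>' unfolding irreducible_rep_def by blast+
  \<comment> \<open>The real functional \<mu>' enters through its complex coercion, since
    \<open>a_power\<close> takes complex exponents.\<close>
  interpret translation G H M A N MH AH NH \<tau> \<tau>' "\<lambda>X. of_real (\<mu>' X)" i \<tau>'' \<mu>'' p \<xi> \<eta> lam \<nu>
    by (intro translation.intro closed_subgroup_pair_axioms translation_axioms.intro)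
      (fact sub subH reps \<tau>'' \<eta> i_equivariant p_equivariant)+
  show ?thesis
    unfolding \<F>_def \<H>_def \<F>'_def \<H>'_def \<phi>_def by (rule conjI[OF hom_section ex1_translation])
qed

end
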